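(* Let $n\in\{1,2,3\}$, let $\Omega=\prod_{j=1}^n(0,L_j)$ with $L_1\ge L_2\ge\cdots\ge L_n>0$, and let the potential be $V_\Omega\equiv 0$. Let $\delta_{\rm loc}(\alpha)=\lambda_2(\alpha)-\lambda_1(\alpha)$ be the fundamental gap of the local fractional Schrödinger operator $A^{(\alpha/2)}+V_\Omega=A^{(\alpha/2)}$ on $\Omega$ with homogeneous Dirichlet boundary conditions. Then for all $0<\alpha\le 2$, $$\delta_{\rm loc}(\alpha)\ \ge\ \begin{cases}\dfrac{(2^{\alpha}-1)\pi^{\alpha}}{D^{\alpha}}, & n=1,\\[2mm] \dfrac{\alpha\,\pi^{\alpha}}{(n+2)^{1-\alpha/2}}\,\dfrac{d^{\,2-\alpha}}{D^2}, & n\ge 2,\end{cases}$$ where $D=\sqrt{\sum_{j=1}^n L_j^2}$ is the diameter of $\Omega$ and $d=L_n$ is the diameter of the largest inscribed ball in $\Omega$.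
   Context: Local fractional Laplacian: for a bounded open domain $\Omega\subset\mathbb{R}^n$, let $\lambda_{\mathbf m}$ and $u_{\mathbf m}$ be the eigenvalues and corresponding eigenfunctions (an orthogonal basis of $L^2(\Omega)$) of $-\Delta$ on $\Omega$ with homogeneous Dirichlet boundary condition. For $0<\alpha\le2$ and $\phi=\sum_{\mathbf m}a_{\mathbf m}u_{\mathbf m}$, define $A^{(\alpha/2)}\phi=\sum_{\mathbf m}a_{\mathbf m}\lambda_{\mathbf m}^{\alpha/2}u_{\mathbf m}$ (so $A^{(1)}=-\Delta$). The eigenvalue problem of the local fractional Schrödinger operator is $[A^{(\alpha/2)}+V_\Omega(\mathbf x)]\phi=\lambda\phi$ in $\Omega$, $\phi=0$ on $\partial\Omega$, with $\phi\ne0$. Its fundamental gap is $\delta_{\rm loc}(\alpha)=\lambda_2(\alpha)-\lambda_1(\alpha)>0$, where $0<\lambda_1(\alpha)<\lambda_2(\alpha)$ are the two smallest distinct eigenvalues. *)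

theory Defs
  imports "HOL-Analysis.Analysis"
begin

definition partial_derivative :: "'a::euclidean_space \<Rightarrow> ('a \<Rightarrow> real) \<Rightarrow> 'a \<Rightarrow> real" where
  "partial_derivative i f x = frechet_derivative f (at x) i"

definition laplacian :: "('a::euclidean_space \<Rightarrow> real) \<Rightarrow> 'a \<Rightarrow> real" where
  "laplacian f x = (\<Sum>i\<in>Basis. partial_derivative i (partial_derivative i f) x)"

(* Meant for open S. *)
definition C2_on :: "'a::euclidean_space set \<Rightarrow> ('a \<Rightarrow> real) \<Rightarrow> bool" where
  "C2_on S f \<longleftrightarrow>
     f differentiable_on S \<and>
     (\<forall>i\<in>Basis. partial_derivative i f differentiable_on S) \<and>
     (\<forall>i\<in>Basis. \<forall>j\<in>Basis. continuous_on S (partial_derivative j (partial_derivative i f)))"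

definition L2_on :: "'a::euclidean_space set \<Rightarrow> ('a \<Rightarrow> real) set" where
  "L2_on S = {f. f \<in> borel_measurable (lebesgue_on S) \<and>
                 integrable (lebesgue_on S) (\<lambda>x. (f x)\<^sup>2)}"

(* The series of the g m converges to f in the norm of L^2(S). The membership conditions
   are needed because the Bochner integral of a non-integrable function is 0. *)
definition L2_sums ::
    "'a::euclidean_space set \<Rightarrow> (nat \<Rightarrow> 'a \<Rightarrow> real) \<Rightarrow> ('a \<Rightarrow> real) \<Rightarrow> bool" where
  "L2_sums S g f \<longleftrightarrow>
     f \<in> L2_on S \<and> (\<forall>m. g m \<in> L2_on S) \<and>
     (\<lambda>N. LINT x|lebesgue_on S. (f x - (\<Sum>m<N. g m x))\<^sup>2) \<longlonglongrightarrow> 0"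

definition L2_orthogonal_basis ::
    "'a::euclidean_space set \<Rightarrow> (nat \<Rightarrow> 'a \<Rightarrow> real) \<Rightarrow> bool" where
  "L2_orthogonal_basis S u \<longleftrightarrow>
     (\<forall>m. u m \<in> L2_on S \<and> (LINT x|lebesgue_on S. (u m x)\<^sup>2) \<noteq> 0) \<and>
     (\<forall>m k. m \<noteq> k \<longrightarrow> (LINT x|lebesgue_on S. u m x * u k x) = 0) \<and>
     (\<forall>f\<in>L2_on S. \<exists>a. L2_sums S (\<lambda>m x. a m * u m x) f)"

definition dirichlet_eigenfunction ::
    "'a::euclidean_space set \<Rightarrow> real \<Rightarrow> ('a \<Rightarrow> real) \<Rightarrow> bool" where
  "dirichlet_eigenfunction \<Omega> l u \<longleftrightarrow>
     C2_on \<Omega> u \<and> continuous_on (closure \<Omega>) u \<and>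
     (\<forall>x\<in>\<Omega>. - laplacian u x = l * u x) \<and>
     (\<forall>x\<in>frontier \<Omega>. u x = 0) \<and>
     (\<exists>x\<in>\<Omega>. u x \<noteq> 0)"

definition dirichlet_eigenbasis ::
    "'a::euclidean_space set \<Rightarrow> (nat \<Rightarrow> real) \<Rightarrow> (nat \<Rightarrow> 'a \<Rightarrow> real) \<Rightarrow> bool" where
  "dirichlet_eigenbasis \<Omega> lam u \<longleftrightarrow>
     L2_orthogonal_basis \<Omega> u \<and> (\<forall>m. dirichlet_eigenfunction \<Omega> (lam m) (u m))"

(* The graph of the (unbounded) operator A^(alpha/2): phi lies in its domain and is mapped
   to psi. The operator does not depend on the choice of the eigenbasis; quantifying it
   existentially leaves the graph empty if the domain has no such basis, so that nothing
   about the operator holds vacuously. *)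
definition local_frac_laplacian ::
    "'a::euclidean_space set \<Rightarrow> real \<Rightarrow> ('a \<Rightarrow> real) \<Rightarrow> ('a \<Rightarrow> real) \<Rightarrow> bool" where
  "local_frac_laplacian \<Omega> \<alpha> \<phi> \<psi> \<longleftrightarrow>
     (\<exists>lam u a. dirichlet_eigenbasis \<Omega> lam u \<and>
        L2_sums \<Omega> (\<lambda>m x. a m * u m x) \<phi> \<and>
        L2_sums \<Omega> (\<lambda>m x. a m * lam m powr (\<alpha> / 2) * u m x) \<psi>)"

(* The equation is an identity in L^2, hence holds almost everywhere; the boundary condition
   is read classically, for the continuous representative of phi. *)
definition local_schroedinger_eigenvalue ::
    "'a::euclidean_space set \<Rightarrow> ('a \<Rightarrow> real) \<Rightarrow> real \<Rightarrow> real \<Rightarrow> bool" where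
  "local_schroedinger_eigenvalue \<Omega> V \<alpha> l \<longleftrightarrow>
     (\<exists>\<phi> \<psi>. local_frac_laplacian \<Omega> \<alpha> \<phi> \<psi> \<and>
        (AE x in lebesgue_on \<Omega>. \<psi> x + V x * \<phi> x = l * \<phi> x) \<and>
        continuous_on (closure \<Omega>) \<phi> \<and>
        (\<forall>x\<in>frontier \<Omega>. \<phi> x = 0) \<and>
        (\<exists>x\<in>\<Omega>. \<phi> x \<noteq> 0))"

(* Here LEAST is a definite description on the reals: it is unspecified unless the minimum
   is attained. *)
definition local_first_eigenvalue ::
    "'a::euclidean_space set \<Rightarrow> ('a \<Rightarrow> real) \<Rightarrow> real \<Rightarrow> real" where
  "local_first_eigenvalue \<Omega> V \<alpha> = (LEAST l. local_schroedinger_eigenvalue \<Omega> V \<alpha> l)"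

definition local_second_eigenvalue ::
    "'a::euclidean_space set \<Rightarrow> ('a \<Rightarrow> real) \<Rightarrow> real \<Rightarrow> real" where
  "local_second_eigenvalue \<Omega> V \<alpha> =
     (LEAST l. local_schroedinger_eigenvalue \<Omega> V \<alpha> l \<and> l \<noteq> local_first_eigenvalue \<Omega> V \<alpha>)"

definition local_fundamental_gap ::
    "'a::euclidean_space set \<Rightarrow> ('a \<Rightarrow> real) \<Rightarrow> real \<Rightarrow> real" where
  "local_fundamental_gap \<Omega> V \<alpha> =
     local_second_eigenvalue \<Omega> V \<alpha> - local_first_eigenvalue \<Omega> V \<alpha>"

end

theory Submission
  imports Defs
begin

text \<open>
  The product sine functions $\prod_c \sin(m_c \pi x_c / L_c)$ with positive integers $m_c$ are an
  orthogonal basis of $L^2$ of the box consisting of Dirichlet eigenfunctions, with eigenvalues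
  $\sum_c (m_c \pi / L_c)^2$. Once it is known that the classical Dirichlet eigenvalues of the box
  are exactly these numbers, the spectrum of the fractional operator consists of their powers with
  exponent $\alpha/2$. The smallest eigenvalue $E$ belongs to $m = (1,\dots,1)$, and the next distinct
  one arises by doubling the frequency along the longest side, which adds $3 (\pi/L_1)^2$. The gap is
  therefore $(E + 3(\pi/L_1)^2)^{\alpha/2} - E^{\alpha/2}$. For $n = 1$ this is the claimed number;
  for $n \ge 2$ the mean value theorem for the concave power function gives the bound, because
  $E + 3 (\pi/L_1)^2 \le (n+3) (\pi/d)^2$ and $L_1 \le D$.

  Two facts carry the analysis. The first is the completeness of the sines
  (\<open>sine_span_dense\<close>). Every $L^2$ function is approximated by the product of the ground state and a
  continuous function. The functions $p$ such that multiplication by $p$ maps the span of the sines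
  into itself form an algebra that contains the separating functions $\cos(\pi x_c/L_c)$, so by the
  Stone-Weierstrass theorem the continuous factor can be replaced by such a $p$, and the product lies
  in the span.

  The second is that an arbitrary classical eigenfunction $u$ with eigenvalue $\lambda$ satisfies
  $(\mu - \lambda) \int v u = 0$ for every product sine $v$ with eigenvalue $\mu$
  (\<open>Green_identity\<close>). The derivatives of $u$ may be unbounded near the boundary, so
  Green's identity is not applied to $u$ but to the functions $u((1-r) L/2 + r x)$ with $r < 1$, which
  are $C^2$ up to the boundary. Since $v$ vanishes on the boundary, the boundary terms contain only
  boundary values of this function, and these tend to $0$ as $r \to 1$ by the uniform continuity
  of $u$. If $\lambda$ is none of the numbers $\mu$, then $u$ is orthogonal to all sines, hence zero.

  The eigenbasis in the definition of the fractional operator is arbitrary. If $\phi$ is mapped to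
  $l \phi$, comparing the coefficients of these two functions shows that each eigenvalue $l$ of the fractional operator
  is the power of a classical Dirichlet eigenvalue (\<open>schroedinger_eigenvalue_imp_powr\<close>).
\<close>

section \<open>Orthogonal series in $L^2$\<close>

definition L2_inner :: "'a::euclidean_space set \<Rightarrow> ('a \<Rightarrow> real) \<Rightarrow> ('a \<Rightarrow> real) \<Rightarrow> real" where
  "L2_inner S f g = (LINT x|lebesgue_on S. f x * g x)"

lemma L2_inner_commute: "L2_inner S f g = L2_inner S g f"
  by (simp add: L2_inner_def mult.commute)

lemma L2_measurable [measurable_dest]: "f \<in> L2_on S \<Longrightarrow> f \<in> borel_measurable (lebesgue_on S)"
  by (simp add: L2_on_def)

lemma L2_mult_integrable:
  assumes "f \<in> L2_on S" "g \<in> L2_on S"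
  shows "integrable (lebesgue_on S) (\<lambda>x. f x * g x)"
proof (rule Bochner_Integration.integrable_bound)
  show "integrable (lebesgue_on S) (\<lambda>x. (f x)\<^sup>2 + (g x)\<^sup>2)"
    using assms by (simp add: L2_on_def)
  show "(\<lambda>x. f x * g x) \<in> borel_measurable (lebesgue_on S)"
    using assms by measurable
  have "\<bar>a * b\<bar> \<le> a\<^sup>2 + b\<^sup>2" for a b :: real
  proof -
    have "2 * \<bar>a\<bar> * \<bar>b\<bar> \<le> \<bar>a\<bar>\<^sup>2 + \<bar>b\<bar>\<^sup>2" by (rule sum_squares_bound)
    moreover have "0 \<le> \<bar>a\<bar> * \<bar>b\<bar>" by simp
    ultimately show ?thesis unfolding abs_mult power2_abs by linarith
  qed
  then show "AE x in lebesgue_on S. norm (f x * g x) \<le> norm ((f x)\<^sup>2 + (g x)\<^sup>2)"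
    by (intro AE_I2) auto
qed

lemma L2_add:
  assumes "f \<in> L2_on S" "g \<in> L2_on S"
  shows "(\<lambda>x. f x + g x) \<in> L2_on S"
proof -
  have "integrable (lebesgue_on S) (\<lambda>x. (f x)\<^sup>2 + (g x)\<^sup>2 + 2 * (f x * g x))"
    using assms L2_mult_integrable[OF assms] by (simp add: L2_on_def)
  moreover have "(\<lambda>x. f x + g x) \<in> borel_measurable (lebesgue_on S)"
    using assms by measurable
  ultimately show ?thesis
    by (simp add: L2_on_def power2_sum algebra_simps)
qed

lemma L2_cmult:
  assumes "f \<in> L2_on S"
  shows "(\<lambda>x. c * f x) \<in> L2_on S"
proof -
  have "(\<lambda>x. c * f x) \<in> borel_measurable (lebesgue_on S)"
    using assms by measurable
  moreover have "integrable (lebesgue_on S) (\<lambda>x. (c * f x)\<^sup>2)"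
    using assms by (simp add: L2_on_def power_mult_distrib)
  ultimately show ?thesis
    unfolding L2_on_def by blast
qed

lemma L2_diff:
  assumes "f \<in> L2_on S" "g \<in> L2_on S"
  shows "(\<lambda>x. f x - g x) \<in> L2_on S"
  using L2_add[OF assms(1) L2_cmult[OF assms(2), of "-1"]] by simp

lemma L2_zero: "(\<lambda>x. 0) \<in> L2_on S"
  by (simp add: L2_on_def)

lemma L2_sum:
  assumes "\<And>i. i \<in> F \<Longrightarrow> f i \<in> L2_on S"
  shows "(\<lambda>x. \<Sum>i\<in>F. f i x) \<in> L2_on S"
  using assms
proof (induction F rule: infinite_finite_induct)
  case (insert i F)
  then show ?case
    using L2_add[of "f i" S "\<lambda>x. \<Sum>i\<in>F. f i x"] by simp
qed (simp_all add: L2_zero)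

lemma L2_inner_diff_left:
  assumes "f \<in> L2_on S" "g \<in> L2_on S" "h \<in> L2_on S"
  shows "L2_inner S (\<lambda>x. f x - g x) h = L2_inner S f h - L2_inner S g h"
  using assms by (simp add: L2_inner_def left_diff_distrib L2_mult_integrable)

lemma L2_inner_cmult_left: "L2_inner S (\<lambda>x. c * f x) h = c * L2_inner S f h"
  by (simp add: L2_inner_def mult.assoc)

lemma L2_inner_cmult_right: "L2_inner S f (\<lambda>x. c * h x) = c * L2_inner S f h"
  by (simp add: L2_inner_def mult.left_commute)

lemma L2_inner_sum_left:
  assumes "\<And>i. i \<in> F \<Longrightarrow> f i \<in> L2_on S" "h \<in> L2_on S"
  shows "L2_inner S (\<lambda>x. \<Sum>i\<in>F. f i x) h = (\<Sum>i\<in>F. L2_inner S (f i) h)"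
  using assms by (simp add: L2_inner_def sum_distrib_right L2_mult_integrable)

lemma L2_inner_self_nonneg: "0 \<le> L2_inner S f f"
  by (simp add: L2_inner_def)

lemma L2_inner_cong_AE:
  assumes "AE x in lebesgue_on S. f x = g x" "f \<in> L2_on S" "g \<in> L2_on S" "h \<in> L2_on S"
  shows "L2_inner S f h = L2_inner S g h"
  unfolding L2_inner_def
  using assms by (intro integral_cong_AE) (auto simp: L2_on_def)

lemma L2_inner_diff_self:
  assumes f: "f \<in> L2_on S" and g: "g \<in> L2_on S"
  shows "L2_inner S (\<lambda>x. f x - g x) (\<lambda>x. f x - g x)
    = L2_inner S f f - 2 * L2_inner S f g + L2_inner S g g"
proof -
  note fg = L2_diff[OF f g]
  have "L2_inner S (\<lambda>x. f x - g x) (\<lambda>x. f x - g x)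
      = L2_inner S f (\<lambda>x. f x - g x) - L2_inner S g (\<lambda>x. f x - g x)"
    by (rule L2_inner_diff_left[OF f g fg])
  also have "L2_inner S f (\<lambda>x. f x - g x) = L2_inner S f f - L2_inner S f g"
    using L2_inner_diff_left[OF f g f] by (simp add: L2_inner_commute)
  also have "L2_inner S g (\<lambda>x. f x - g x) = L2_inner S f g - L2_inner S g g"
    using L2_inner_diff_left[OF f g g] by (simp add: L2_inner_commute)
  finally show ?thesis by simp
qed

text \<open>The quadratic polynomial $t \mapsto \|f - t g\|^2$ is nonnegative; it is evaluated at its minimum
  $t = \langle f,g\rangle / \|g\|^2$, or, if $\|g\| = 0$, at a point where it would be $-1$ unless
  $\langle f,g\rangle = 0$.\<close>

lemma L2_Cauchy_Schwarz:
  assumes f: "f \<in> L2_on S" and g: "g \<in> L2_on S"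
  shows "(L2_inner S f g)\<^sup>2 \<le> L2_inner S f f * L2_inner S g g"
proof -
  define a b c where "a = L2_inner S f f" and "b = L2_inner S f g" and "c = L2_inner S g g"
  have quad: "0 \<le> a - 2 * t * b + t\<^sup>2 * c" for t
  proof -
    have "0 \<le> L2_inner S (\<lambda>x. f x - t * g x) (\<lambda>x. f x - t * g x)"
      by (rule L2_inner_self_nonneg)
    also have "\<dots> = a - 2 * L2_inner S f (\<lambda>x. t * g x)
        + L2_inner S (\<lambda>x. t * g x) (\<lambda>x. t * g x)"
      unfolding a_def by (rule L2_inner_diff_self[OF f L2_cmult[OF g]])
    also have "\<dots> = a - 2 * t * b + t\<^sup>2 * c"
      by (simp add: L2_inner_cmult_left L2_inner_cmult_right b_def c_def power2_eq_square)
    finally show ?thesis .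
  qed
  have c0: "0 \<le> c" by (simp add: c_def L2_inner_self_nonneg)
  show ?thesis
  proof (cases "c = 0")
    case True
    have "b = 0"
    proof (rule ccontr)
      assume "b \<noteq> 0"
      then show False
        using quad[of "(a + 1) / (2 * b)"] True by (simp add: field_simps)
    qed
    then show ?thesis using True by (simp add: b_def c_def)
  next
    case False
    then have "0 \<le> a - b\<^sup>2 / c"
      using quad[of "b / c"] by (simp add: field_simps power2_eq_square)
    then show ?thesis
      using False c0 by (simp add: a_def[symmetric] b_def[symmetric] c_def[symmetric] field_simps)
  qed
qed

text \<open>The Cauchy-Schwarz inequality makes $\langle\cdot,h\rangle$ continuous, so it can be applied to a
  series term by term.\<close>

lemma L2_sums_inner:
  assumes sums: "L2_sums S g f" and h: "h \<in> L2_on S"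
  shows "(\<lambda>N. \<Sum>m<N. L2_inner S (g m) h) \<longlonglongrightarrow> L2_inner S f h"
proof -
  define r where "r N x = f x - (\<Sum>m<N. g m x)" for N x
  have f: "f \<in> L2_on S" and g: "\<And>m. g m \<in> L2_on S"
    and lim: "(\<lambda>N. L2_inner S (r N) (r N)) \<longlonglongrightarrow> 0"
    using sums by (simp_all add: L2_sums_def L2_inner_def r_def power2_eq_square)
  have sm: "(\<lambda>x. \<Sum>m<N. g m x) \<in> L2_on S" for N
    by (intro L2_sum g)
  have r: "r N \<in> L2_on S" for N
    unfolding r_def by (intro L2_diff f sm)
  have "(\<lambda>N. sqrt (L2_inner S (r N) (r N) * L2_inner S h h)) \<longlonglongrightarrow> sqrt (0 * L2_inner S h h)"
    by (intro tendsto_intros lim)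
  then have "(\<lambda>N. sqrt (L2_inner S (r N) (r N) * L2_inner S h h)) \<longlonglongrightarrow> 0" by simp
  moreover have "\<bar>L2_inner S (r N) h\<bar> \<le> sqrt (L2_inner S (r N) (r N) * L2_inner S h h)" for N
    using L2_Cauchy_Schwarz[OF r h] by (simp add: real_le_rsqrt)
  ultimately have "(\<lambda>N. L2_inner S (r N) h) \<longlonglongrightarrow> 0"
    by (intro Lim_null_comparison[of "\<lambda>N. L2_inner S (r N) h"]) (auto intro: always_eventually)
  moreover have "L2_inner S (r N) h = L2_inner S f h - (\<Sum>m<N. L2_inner S (g m) h)" for N
    unfolding r_def by (simp add: L2_inner_diff_left[OF f sm h] L2_inner_sum_left[OF g h])
  ultimately have "(\<lambda>N. L2_inner S f h - (\<Sum>m<N. L2_inner S (g m) h)) \<longlonglongrightarrow> 0" by simp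
  then show ?thesis
    using tendsto_diff[OF tendsto_const[of "L2_inner S f h"]] by fastforce
qed

text \<open>After pairing with $u_k$ the partial sums are constant from $k$ on.\<close>

lemma orthogonal_series_coefficient:
  assumes sums: "L2_sums S (\<lambda>m x. a m * u m x) f"
    and u: "u k \<in> L2_on S" and orth: "\<And>m. m \<noteq> k \<Longrightarrow> L2_inner S (u m) (u k) = 0"
  shows "L2_inner S f (u k) = a k * L2_inner S (u k) (u k)"
proof (rule LIMSEQ_unique[OF L2_sums_inner[OF sums u]])
  have "(\<Sum>m<N. L2_inner S (\<lambda>x. a m * u m x) (u k)) = a k * L2_inner S (u k) (u k)" if "k < N" for N
  proof -
    have "(\<Sum>m<N. L2_inner S (\<lambda>x. a m * u m x) (u k))
        = (\<Sum>m<N. if m = k then a k * L2_inner S (u k) (u k) else 0)"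
      by (intro sum.cong) (auto simp: L2_inner_cmult_left orth)
    then show ?thesis using that by simp
  qed
  then show "(\<lambda>N. \<Sum>m<N. L2_inner S (\<lambda>x. a m * u m x) (u k))
      \<longlonglongrightarrow> a k * L2_inner S (u k) (u k)"
    by (intro tendsto_eventually eventually_sequentiallyI[of "Suc k"]) simp
qed

lemma L2_orthogonal_basis_coefficient:
  assumes "L2_orthogonal_basis S u" "L2_sums S (\<lambda>m x. a m * u m x) f"
  shows "L2_inner S f (u k) = a k * L2_inner S (u k) (u k)"
  using assms by (intro orthogonal_series_coefficient) (auto simp: L2_orthogonal_basis_def L2_inner_def)

lemma L2_orthogonal_basis_total:
  assumes basis: "L2_orthogonal_basis S u" and f: "f \<in> L2_on S"
    and orth: "\<And>k. L2_inner S f (u k) = 0"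
  shows "L2_inner S f f = 0"
proof -
  obtain a where a: "L2_sums S (\<lambda>m x. a m * u m x) f"
    using basis f by (auto simp: L2_orthogonal_basis_def)
  have "a k = 0" for k
    using L2_orthogonal_basis_coefficient[OF basis a, of k] orth[of k] basis
    by (auto simp: L2_orthogonal_basis_def L2_inner_def power2_eq_square)
  then have "(\<lambda>N. L2_inner S f f) \<longlonglongrightarrow> 0"
    using a by (simp add: L2_sums_def L2_inner_def power2_eq_square)
  then show ?thesis by (simp add: LIMSEQ_const_iff)
qed

text \<open>A continuous function that vanishes almost everywhere on an open set vanishes there, because the
  set where it is nonzero is open and a nonempty open set is not negligible.\<close>

lemma L2_inner_pos_of_continuous:
  assumes "open S" "continuous_on S f" "f \<in> L2_on S" "x \<in> S" "f x \<noteq> 0"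
  shows "L2_inner S f f \<noteq> 0"
proof
  assume "L2_inner S f f = 0"
  then have "AE x in lebesgue_on S. (f x)\<^sup>2 = 0"
    using assms(3) by (subst integral_nonneg_eq_0_iff_AE[symmetric])
      (auto simp: L2_inner_def L2_on_def power2_eq_square)
  then have "AE x in lebesgue. x \<in> S \<longrightarrow> f x = 0"
    using assms(1) by (simp add: AE_restrict_space_iff)
  then have "negligible {x. \<not> (x \<in> S \<longrightarrow> f x = 0)}"
    unfolding eventually_ae_filter_negligible using negligible_subset by blast
  moreover have "open {x \<in> S. f x \<noteq> 0}"
    using continuous_open_preimage[OF assms(2,1), of "- {0}"]
    by (simp add: vimage_def Int_def conj_commute open_Compl)
  ultimately show False
    using assms(4,5) open_not_negligible[of "{x \<in> S. f x \<noteq> 0}"] by auto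
qed

text \<open>If $\phi = \sum_m a_m u_m$ and $\sum_m a_m \lambda_m^{\alpha/2} u_m = l \phi$ almost everywhere, then
  $a_m \lambda_m^{\alpha/2} = l a_m$ for all $m$, and $a_k \ne 0$ for some $k$ since $\phi$ is not zero
  in $L^2$.\<close>

lemma schroedinger_eigenvalue_imp_powr:
  assumes S: "open S" and ev: "local_schroedinger_eigenvalue S (\<lambda>x. 0) \<alpha> l"
  obtains mu u where "dirichlet_eigenfunction S mu u" "u \<in> L2_on S" "l = mu powr (\<alpha> / 2)"
proof -
  obtain \<phi> \<psi> lam u a x where basis: "dirichlet_eigenbasis S lam u"
    and phi: "L2_sums S (\<lambda>m x. a m * u m x) \<phi>"
    and psi: "L2_sums S (\<lambda>m x. a m * lam m powr (\<alpha> / 2) * u m x) \<psi>"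
    and eq: "AE x in lebesgue_on S. \<psi> x = l * \<phi> x"
    and cont: "continuous_on (closure S) \<phi>" and x: "x \<in> S" "\<phi> x \<noteq> 0"
    using ev unfolding local_schroedinger_eigenvalue_def local_frac_laplacian_def by auto
  have ob: "L2_orthogonal_basis S u" using basis by (simp add: dirichlet_eigenbasis_def)
  then have u: "u k \<in> L2_on S" "L2_inner S (u k) (u k) \<noteq> 0" for k
    by (auto simp: L2_orthogonal_basis_def L2_inner_def power2_eq_square)
  have L2: "\<phi> \<in> L2_on S" "\<psi> \<in> L2_on S" using phi psi by (auto simp: L2_sums_def)
  have "L2_inner S \<phi> \<phi> \<noteq> 0"
    using S x L2 continuous_on_subset[OF cont closure_subset]
    by (intro L2_inner_pos_of_continuous) auto
  then obtain k where k: "L2_inner S \<phi> (u k) \<noteq> 0"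
    using L2_orthogonal_basis_total[OF ob L2(1)] by auto
  have "L2_inner S \<psi> (u k) = l * L2_inner S \<phi> (u k)"
    using L2_inner_cong_AE[OF eq L2(2) L2_cmult[OF L2(1)] u(1)[of k]]
    by (simp add: L2_inner_cmult_left)
  then have "lam k powr (\<alpha> / 2) = l"
    using k u(2)[of k] L2_orthogonal_basis_coefficient[OF ob phi, of k]
      L2_orthogonal_basis_coefficient[OF ob psi, of k] by auto
  moreover have "dirichlet_eigenfunction S (lam k) (u k)"
    using basis by (simp add: dirichlet_eigenbasis_def)
  ultimately show thesis using that u(1) by blast
qed

text \<open>With $a_m$ the Fourier coefficients, $\|f - \sum_m c_m u_m\|^2 = \|f\|^2 +
  \sum_m ((c_m - a_m)^2 - a_m^2) \|u_m\|^2$, which is smallest for $c = a$.\<close>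

lemma best_approximation:
  assumes f: "f \<in> L2_on S" and u: "\<And>m. u m \<in> L2_on S"
    and orth: "\<And>m k. m \<noteq> k \<Longrightarrow> L2_inner S (u m) (u k) = 0"
    and nz: "\<And>m. L2_inner S (u m) (u m) \<noteq> 0" and F: "finite F"
  defines "a m \<equiv> L2_inner S f (u m) / L2_inner S (u m) (u m)"
  shows "L2_inner S (\<lambda>x. f x - (\<Sum>m\<in>F. a m * u m x)) (\<lambda>x. f x - (\<Sum>m\<in>F. a m * u m x))
    \<le> L2_inner S (\<lambda>x. f x - (\<Sum>m\<in>F. c m * u m x)) (\<lambda>x. f x - (\<Sum>m\<in>F. c m * u m x))"
proof -
  have expand: "L2_inner S (\<lambda>x. f x - (\<Sum>m\<in>F. b m * u m x)) (\<lambda>x. f x - (\<Sum>m\<in>F. b m * u m x))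
      = L2_inner S f f + (\<Sum>m\<in>F. ((b m - a m)\<^sup>2 - (a m)\<^sup>2) * L2_inner S (u m) (u m))" for b
  proof -
    define p where "p x = (\<Sum>m\<in>F. b m * u m x)" for x
    have p: "p \<in> L2_on S" unfolding p_def by (intro L2_sum L2_cmult u)
    have pinner: "L2_inner S p h = (\<Sum>m\<in>F. b m * L2_inner S (u m) h)" if "h \<in> L2_on S" for h
      unfolding p_def by (subst L2_inner_sum_left[OF L2_cmult[OF u] that])
        (simp add: L2_inner_cmult_left)
    have "L2_inner S (u m) p = b m * L2_inner S (u m) (u m)" if "m \<in> F" for m
    proof -
      have "L2_inner S (u m) p = (\<Sum>k\<in>F. b k * L2_inner S (u k) (u m))"
        by (simp add: L2_inner_commute[of S "u m" p] pinner u)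
      also have "\<dots> = (\<Sum>k\<in>F. if k = m then b m * L2_inner S (u m) (u m) else 0)"
        by (intro sum.cong) (auto simp: orth)
      finally show ?thesis using F that by simp
    qed
    then have "L2_inner S p p = (\<Sum>m\<in>F. (b m)\<^sup>2 * L2_inner S (u m) (u m))"
      by (simp add: pinner p power2_eq_square mult.assoc)
    moreover have "L2_inner S p f = (\<Sum>m\<in>F. b m * a m * L2_inner S (u m) (u m))"
      using nz by (simp add: pinner f a_def L2_inner_commute[of S f] mult.assoc)
    ultimately have "L2_inner S (\<lambda>x. f x - p x) (\<lambda>x. f x - p x) = L2_inner S f f
      - 2 * (\<Sum>m\<in>F. b m * a m * L2_inner S (u m) (u m))
      + (\<Sum>m\<in>F. (b m)\<^sup>2 * L2_inner S (u m) (u m))"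
      by (simp add: L2_inner_diff_self f p L2_inner_commute[of S f p])
    also have "\<dots> = L2_inner S f f
        + (\<Sum>m\<in>F. ((b m - a m)\<^sup>2 - (a m)\<^sup>2) * L2_inner S (u m) (u m))"
      by (simp add: sum_distrib_left sum_subtractf[symmetric] sum.distrib[symmetric] power2_diff
          algebra_simps)
    finally show ?thesis by (simp add: p_def)
  qed
  show ?thesis
    unfolding expand by (intro add_left_mono sum_mono mult_right_mono L2_inner_self_nonneg) simp
qed

text \<open>The definition of an orthogonal basis asks for convergence of an expansion, not just for density of
  the span. By best approximation, the Fourier partial sum up to $N$ is at least as good as any given
  combination of the functions with index below $N$.\<close>

lemma dense_orthogonal_imp_basis:
  assumes u: "\<And>m. u m \<in> L2_on S"
    and orth: "\<And>m k. m \<noteq> k \<Longrightarrow> L2_inner S (u m) (u k) = 0"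
    and nz: "\<And>m. L2_inner S (u m) (u m) \<noteq> 0"
    and dense: "\<And>f e. f \<in> L2_on S \<Longrightarrow> 0 < e \<Longrightarrow> \<exists>F c. finite F \<and>
      L2_inner S (\<lambda>x. f x - (\<Sum>m\<in>F. c m * u m x)) (\<lambda>x. f x - (\<Sum>m\<in>F. c m * u m x)) < e"
  shows "L2_orthogonal_basis S u"
proof -
  have "L2_sums S (\<lambda>m x. (L2_inner S f (u m) / L2_inner S (u m) (u m)) * u m x) f"
    if f: "f \<in> L2_on S" for f
  proof -
    define a where "a m = L2_inner S f (u m) / L2_inner S (u m) (u m)" for m
    define E where "E N = L2_inner S (\<lambda>x. f x - (\<Sum>m<N. a m * u m x))
        (\<lambda>x. f x - (\<Sum>m<N. a m * u m x))" for N
    have "E \<longlonglongrightarrow> 0"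
    proof (rule LIMSEQ_I)
      fix e :: real assume "0 < e"
      then obtain F c where F: "finite F"
        and app: "L2_inner S (\<lambda>x. f x - (\<Sum>m\<in>F. c m * u m x)) (\<lambda>x. f x - (\<Sum>m\<in>F. c m * u m x)) < e"
        using dense[OF f] by blast
      obtain N0 where N0: "F \<subseteq> {..<N0}" using F finite_nat_set_iff_bounded by auto
      have "norm (E N - 0) < e" if "N0 \<le> N" for N
      proof -
        define c' where "c' m = (if m \<in> F then c m else 0)" for m
        have "(\<Sum>m<N. c' m * u m x) = (\<Sum>m\<in>F. c m * u m x)" for x
          using N0 that F by (intro sum.mono_neutral_cong_right) (auto simp: c'_def)
        then have "E N < e"
          using best_approximation[where f=f and u=u and c=c' and F="{..<N}" and S=S, OF f u orth nz] app
          unfolding E_def a_def by simp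
        then show ?thesis using L2_inner_self_nonneg[of S "\<lambda>x. f x - (\<Sum>m<N. a m * u m x)"]
          by (simp add: E_def)
      qed
      then show "\<exists>no. \<forall>n\<ge>no. norm (E n - 0) < e" by blast
    qed
    then have "L2_sums S (\<lambda>m x. a m * u m x) f"
      using f u by (simp add: L2_sums_def E_def[abs_def] L2_inner_def power2_eq_square L2_cmult)
    then show ?thesis by (simp only: a_def)
  qed
  then have "\<exists>a. L2_sums S (\<lambda>m x. a m * u m x) f" if "f \<in> L2_on S" for f
    using that by (intro exI)
  then show ?thesis
    using u orth nz by (simp add: L2_orthogonal_basis_def L2_inner_def power2_eq_square)
qed

section \<open>Product sine functions as Dirichlet eigenfunctions\<close>

definition coord_prod :: "('a::euclidean_space \<Rightarrow> real \<Rightarrow> real) \<Rightarrow> 'a \<Rightarrow> real" where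
  "coord_prod s x = (\<Prod>c\<in>Basis. s c (x \<bullet> c))"

text \<open>Function update in one coordinate singles out one factor. All partial derivatives below are of this
  form: differentiating in direction $b$ replaces the factor at $b$ by its derivative.\<close>

lemma coord_prod_update:
  assumes "b \<in> Basis"
  shows "coord_prod (s(b := g)) x = g (x \<bullet> b) * (\<Prod>c\<in>Basis - {b}. s c (x \<bullet> c))"
proof -
  have "coord_prod (s(b := g)) x = (s(b := g)) b (x \<bullet> b) * (\<Prod>c\<in>Basis - {b}. (s(b := g)) c (x \<bullet> c))"
    unfolding coord_prod_def using assms by (intro prod.remove) auto
  also have "(\<Prod>c\<in>Basis - {b}. (s(b := g)) c (x \<bullet> c)) = (\<Prod>c\<in>Basis - {b}. s c (x \<bullet> c))"
    by (intro prod.cong) auto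
  finally show ?thesis by (simp only: fun_upd_same)
qed

lemma coord_prod_has_derivative:
  fixes s :: "'a::euclidean_space \<Rightarrow> real \<Rightarrow> real"
  assumes s: "\<And>c t. (s c has_real_derivative s' c t) (at t)"
  shows "(coord_prod s has_derivative
    (\<lambda>h. \<Sum>b\<in>Basis. (h \<bullet> b) * coord_prod (s(b := s' b)) x)) (at x)"
proof -
  have "((\<lambda>x. s c (x \<bullet> c)) has_derivative (\<lambda>h. (h \<bullet> c) * s' c (x \<bullet> c))) (at x)" for c
    by (rule DERIV_compose_FDERIV[OF s]) (auto intro!: derivative_eq_intros)
  from has_derivative_prod[OF this]
  have "((\<lambda>x. \<Prod>c\<in>Basis. s c (x \<bullet> c)) has_derivative
      (\<lambda>h. \<Sum>b\<in>Basis. (h \<bullet> b) * s' b (x \<bullet> b) * (\<Prod>c\<in>Basis - {b}. s c (x \<bullet> c)))) (at x)" .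
  also have "(\<lambda>x. \<Prod>c\<in>Basis. s c (x \<bullet> c)) = coord_prod s"
    by (simp add: coord_prod_def fun_eq_iff)
  also have "(\<lambda>h. \<Sum>b\<in>Basis. (h \<bullet> b) * s' b (x \<bullet> b) * (\<Prod>c\<in>Basis - {b}. s c (x \<bullet> c)))
      = (\<lambda>h. \<Sum>b\<in>Basis. (h \<bullet> b) * coord_prod (s(b := s' b)) x)"
    by (simp add: coord_prod_update mult.assoc)
  finally show ?thesis .
qed

lemma partial_derivative_coord_prod:
  fixes s :: "'a::euclidean_space \<Rightarrow> real \<Rightarrow> real"
  assumes "b \<in> Basis" and s: "\<And>c t. (s c has_real_derivative s' c t) (at t)"
  shows "partial_derivative b (coord_prod s) = coord_prod (s(b := s' b))"
proof
  fix x
  have "partial_derivative b (coord_prod s) x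
      = (\<Sum>c\<in>Basis. (b \<bullet> c) * coord_prod (s(c := s' c)) x)"
    unfolding partial_derivative_def
    by (simp add: frechet_derivative_at[OF coord_prod_has_derivative[OF s], symmetric])
  also have "\<dots> = (\<Sum>c\<in>Basis. if c = b then coord_prod (s(b := s' b)) x else 0)"
    using assms(1) by (intro sum.cong) (auto simp: inner_Basis)
  also have "\<dots> = coord_prod (s(b := s' b)) x"
    using assms(1) by simp
  finally show "partial_derivative b (coord_prod s) x = coord_prod (s(b := s' b)) x" .
qed

lemma continuous_on_coord_prod:
  assumes "\<And>c. continuous_on UNIV (s c)"
  shows "continuous_on S (coord_prod s)"
  unfolding coord_prod_def
  by (intro continuous_on_prod continuous_on_compose2[OF assms] continuous_intros) auto

lemma second_partial_derivative_coord_prod: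
  fixes s :: "'a::euclidean_space \<Rightarrow> real \<Rightarrow> real"
  assumes b: "b \<in> Basis" and c: "c \<in> Basis"
    and s: "\<And>c t. (s c has_real_derivative s' c t) (at t)"
    and s': "\<And>c t. (s' c has_real_derivative s'' c t) (at t)"
  shows "partial_derivative c (partial_derivative b (coord_prod s))
    = coord_prod ((s(b := s' b))(c := (s'(b := s'' b)) c))"
  using s' by (subst partial_derivative_coord_prod[OF b s], intro partial_derivative_coord_prod[OF c])
    (auto simp: s)

lemma C2_on_coord_prod:
  fixes s :: "'a::euclidean_space \<Rightarrow> real \<Rightarrow> real"
  assumes s: "\<And>c t. (s c has_real_derivative s' c t) (at t)"
    and s': "\<And>c t. (s' c has_real_derivative s'' c t) (at t)"
    and cont: "\<And>c. continuous_on UNIV (s'' c)"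
  shows "C2_on S (coord_prod s)"
  unfolding C2_on_def
proof (intro conjI ballI)
  show "coord_prod s differentiable_on S"
    using coord_prod_has_derivative[of s s', OF s]
    by (auto simp: differentiable_on_def differentiable_def intro: has_derivative_at_withinI)
  fix b :: 'a assume b: "b \<in> Basis"
  have *: "((s(b := s' b)) c has_real_derivative (s'(b := s'' b)) c t) (at t)" for c t
    using s s' by auto
  show "partial_derivative b (coord_prod s) differentiable_on S"
    using coord_prod_has_derivative[of "s(b := s' b)", OF *]
    by (subst partial_derivative_coord_prod[OF b s])
      (auto simp: differentiable_on_def differentiable_def intro: has_derivative_at_withinI)
  have "continuous_on UNIV (s c)" "continuous_on UNIV (s' c)" for c
    by (rule DERIV_continuous_on[OF has_field_derivative_at_within], rule s,
        rule DERIV_continuous_on[OF has_field_derivative_at_within], rule s')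
  then show "continuous_on S (partial_derivative c (partial_derivative b (coord_prod s)))"
    if "c \<in> Basis" for c
    unfolding second_partial_derivative_coord_prod[OF b that s s']
    using cont by (intro continuous_on_coord_prod) auto
qed

definition sine_freq :: "'a::euclidean_space \<Rightarrow> ('a \<Rightarrow> nat) \<Rightarrow> 'a \<Rightarrow> real" where
  "sine_freq L m c = real (m c) * pi / (L \<bullet> c)"

definition sine_mode :: "'a::euclidean_space \<Rightarrow> ('a \<Rightarrow> nat) \<Rightarrow> 'a \<Rightarrow> real" where
  "sine_mode L m = coord_prod (\<lambda>c t. sin (sine_freq L m c * t))"

definition box_eigenvalue :: "'a::euclidean_space \<Rightarrow> ('a \<Rightarrow> nat) \<Rightarrow> real" where
  "box_eigenvalue L m = (\<Sum>c\<in>Basis. (sine_freq L m c)\<^sup>2)"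

lemma sine_mode_C2: "C2_on S (sine_mode L m)"
  unfolding sine_mode_def
  by (rule C2_on_coord_prod[where s' = "\<lambda>c t. sine_freq L m c * cos (sine_freq L m c * t)"
        and s'' = "\<lambda>c t. - (sine_freq L m c)\<^sup>2 * sin (sine_freq L m c * t)"])
    (auto intro!: derivative_eq_intros continuous_intros simp: power2_eq_square)

lemma continuous_on_sine_mode: "continuous_on S (sine_mode L m)"
  unfolding sine_mode_def by (intro continuous_on_coord_prod continuous_intros)

lemma laplacian_sine_mode: "laplacian (sine_mode L m) x = - box_eigenvalue L m * sine_mode L m x"
proof -
  let ?k = "sine_freq L m"
  have "partial_derivative b (partial_derivative b (sine_mode L m)) x = - (?k b)\<^sup>2 * sine_mode L m x"
    if b: "b \<in> Basis" for b
  proof -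
    define s where "s c t = sin (?k c * t)" for c t
    define s' where "s' c t = ?k c * cos (?k c * t)" for c t
    define s'' where "s'' c t = - (?k c)\<^sup>2 * sin (?k c * t)" for c t
    have s: "(s c has_real_derivative s' c t) (at t)" for c t
      unfolding s_def s'_def by (auto intro!: derivative_eq_intros)
    have s': "(s' c has_real_derivative s'' c t) (at t)" for c t
      unfolding s'_def s''_def by (auto intro!: derivative_eq_intros simp: power2_eq_square)
    have mode: "sine_mode L m = coord_prod s"
      by (simp add: sine_mode_def s_def[abs_def])
    have "partial_derivative b (partial_derivative b (sine_mode L m)) x
        = coord_prod (s(b := \<lambda>t. - (?k b)\<^sup>2 * sin (?k b * t))) x"
      unfolding mode second_partial_derivative_coord_prod[of b b s, OF b b s s']
      by (simp add: s''_def[abs_def])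
    also have "\<dots> = - (?k b)\<^sup>2 * coord_prod (s(b := s b)) x"
      unfolding coord_prod_update[OF b] by (simp add: s_def mult.assoc)
    also have "coord_prod (s(b := s b)) = sine_mode L m"
      by (simp add: mode)
    finally show ?thesis .
  qed
  then show ?thesis
    by (simp add: laplacian_def box_eigenvalue_def sum_distrib_right sum_negf)
qed

context
  fixes L :: "'a::euclidean_space"
  assumes L: "\<And>c. c \<in> Basis \<Longrightarrow> 0 < L \<bullet> c"
begin

lemma box_nonempty: "box 0 L \<noteq> {}"
  using L by (simp add: box_ne_empty)

text \<open>At the point with coordinates $L_c/(2 m_c)$ every factor is $\sin(\pi/2) = 1$.\<close>

lemma sine_mode_nonzero:
  assumes "\<And>c. c \<in> Basis \<Longrightarrow> 0 < m c"
  shows "\<exists>x\<in>box 0 L. sine_mode L m x \<noteq> 0"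
proof
  define x where "x = (\<Sum>c\<in>Basis. (L \<bullet> c / (2 * real (m c))) *\<^sub>R c)"
  have x: "x \<bullet> c = L \<bullet> c / (2 * real (m c))" if "c \<in> Basis" for c
    using that by (simp add: x_def)
  have "L \<bullet> c / (2 * real (m c)) < L \<bullet> c" if "c \<in> Basis" for c
  proof -
    have "1 \<le> real (m c)" using assms[OF that] by linarith
    then show ?thesis using L[OF that] by (simp add: field_simps)
  qed
  then show "x \<in> box 0 L"
    using L assms by (simp add: mem_box x)
  have "sin (sine_freq L m c * (x \<bullet> c)) = 1" if "c \<in> Basis" for c
    using L[OF that] assms[OF that] by (simp add: sine_freq_def x that)
  then show "sine_mode L m x \<noteq> 0"
    by (simp add: sine_mode_def coord_prod_def)
qed

lemma sine_mode_eq_0: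
  assumes "b \<in> Basis" "x \<bullet> b = 0 \<or> x \<bullet> b = L \<bullet> b"
  shows "sine_mode L m x = 0"
proof -
  have "sin (sine_freq L m b * (x \<bullet> b)) = 0"
    using assms L[OF assms(1)] by (auto simp: sine_freq_def)
  then show ?thesis
    using assms(1) by (auto simp: sine_mode_def coord_prod_def intro!: prod_zero)
qed

lemma frontier_box_coordinate:
  assumes "x \<in> frontier (box 0 L)"
  obtains b where "b \<in> Basis" "x \<bullet> b = 0 \<or> x \<bullet> b = L \<bullet> b"
proof -
  have "x \<in> cbox 0 L" "x \<notin> box 0 L"
    using assms box_nonempty by (auto simp: frontier_box)
  then obtain b where "b \<in> Basis" "\<not> (0 < x \<bullet> b \<and> x \<bullet> b < L \<bullet> b)" "0 \<le> x \<bullet> b" "x \<bullet> b \<le> L \<bullet> b"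
    by (auto simp: mem_box)
  then have "b \<in> Basis" "x \<bullet> b = 0 \<or> x \<bullet> b = L \<bullet> b" by linarith+
  then show thesis by (rule that)
qed

lemma sine_mode_dirichlet:
  assumes "\<And>c. c \<in> Basis \<Longrightarrow> 0 < m c"
  shows "dirichlet_eigenfunction (box 0 L) (box_eigenvalue L m) (sine_mode L m)"
  unfolding dirichlet_eigenfunction_def
  using sine_mode_nonzero[OF assms] sine_mode_eq_0
  by (auto simp: sine_mode_C2 continuous_on_sine_mode laplacian_sine_mode elim!: frontier_box_coordinate)

end

section \<open>Integration over boxes and orthogonality of the sines\<close>

text \<open>Lebesgue measure on a Euclidean space is the image of a product measure indexed by the basis. This
  reduces integrals of coordinate products and integration along coordinate lines to Fubini's
  theorem for finite product measures.\<close>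

lemma lborel_integral_coordinates:
  fixes h :: "'a::euclidean_space \<Rightarrow> real"
  assumes h: "h \<in> borel_measurable borel"
  shows "integral\<^sup>L lborel h
    = (\<integral>f. h (\<Sum>c\<in>Basis. f c *\<^sub>R c) \<partial>(\<Pi>\<^sub>M c\<in>Basis. lborel))"
  by (subst lborel_eq, rule integral_distr) (use h in measurable)

lemma lborel_integrable_coordinates:
  fixes h :: "'a::euclidean_space \<Rightarrow> real"
  assumes h: "integrable lborel h"
  shows "integrable (\<Pi>\<^sub>M c\<in>Basis. lborel) (\<lambda>f. h (\<Sum>c\<in>Basis. f c *\<^sub>R c))"
proof -
  have "integrable (distr (\<Pi>\<^sub>M c\<in>Basis. lborel) borel (\<lambda>f. \<Sum>c\<in>Basis. f c *\<^sub>R c)) h"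
    using h by (subst (asm) lborel_eq)
  moreover have "(\<lambda>f. \<Sum>c\<in>Basis. f c *\<^sub>R c) \<in> measurable (\<Pi>\<^sub>M c\<in>Basis. lborel) (borel :: 'a measure)"
    by measurable
  ultimately show ?thesis
    using borel_measurable_integrable[OF h] by (subst (asm) integrable_distr_eq) auto
qed

lemma continuous_integrable_lborel_cbox:
  fixes g :: "'a::euclidean_space \<Rightarrow> real"
  assumes "continuous_on (cbox p q) g"
  shows "integrable lborel (\<lambda>x. indicator (cbox p q) x * g x)"
  using borel_integrable_compact[OF compact_cbox assms] by simp

lemma integral_cbox_eq_lborel:
  fixes g :: "'a::euclidean_space \<Rightarrow> real"
  assumes "continuous_on (cbox p q) g"
  shows "integral (cbox p q) g = (LINT x|lborel. indicator (cbox p q) x * g x)"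
proof -
  have "set_integrable lborel (cbox p q) g"
    using borel_integrable_compact[OF compact_cbox assms] by (simp add: set_integrable_def)
  from set_borel_integral_eq_integral(2)[OF this] show ?thesis
    by (simp add: set_lebesgue_integral_def)
qed

lemma integrable_lebesgue_on_box:
  fixes g :: "'a::euclidean_space \<Rightarrow> real"
  assumes "continuous_on (cbox p q) g"
  shows "integrable (lebesgue_on (box p q)) g"
proof -
  have "set_integrable lebesgue (cbox p q) g"
    using continuous_imp_integrable[OF assms] by (simp add: set_integrable_def integrable_restrict_space)
  then have "set_integrable lebesgue (box p q) g"
    by (rule set_integrable_subset) (auto intro: box_subset_cbox[THEN subsetD])
  then show ?thesis by (simp add: set_integrable_def integrable_restrict_space)
qed

lemma lebesgue_integral_box:
  fixes g :: "'a::euclidean_space \<Rightarrow> real"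
  assumes "continuous_on (cbox p q) g"
  shows "(LINT x|lebesgue_on (box p q). g x) = integral (cbox p q) g"
  using lebesgue_integral_eq_integral[OF integrable_lebesgue_on_box[OF assms]]
  by (simp add: integral_open_interval)

lemma L2_continuous:
  fixes g :: "'a::euclidean_space \<Rightarrow> real"
  assumes "continuous_on (cbox p q) g"
  shows "g \<in> L2_on (box p q)"
  unfolding L2_on_def
  using integrable_lebesgue_on_box[OF assms]
    integrable_lebesgue_on_box[OF continuous_on_power[OF assms, of 2]] by auto

lemma L2_inner_continuous:
  fixes g :: "'a::euclidean_space \<Rightarrow> real"
  assumes "continuous_on (cbox p q) f" "continuous_on (cbox p q) g"
  shows "L2_inner (box p q) f g = integral (cbox p q) (\<lambda>x. f x * g x)"
  unfolding L2_inner_def using assms by (intro lebesgue_integral_box continuous_intros)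

lemma indicator_cbox_coordinates:
  "indicator (cbox p q) x = (\<Prod>c\<in>Basis. indicator {p \<bullet> c..q \<bullet> c} (x \<bullet> c) :: real)"
proof (cases "x \<in> cbox p q")
  case True
  then show ?thesis by (auto simp: mem_box intro!: prod.neutral[symmetric])
next
  case False
  then obtain c where "c \<in> Basis" "\<not> (p \<bullet> c \<le> x \<bullet> c \<and> x \<bullet> c \<le> q \<bullet> c)"
    by (auto simp: mem_box)
  then show ?thesis
    using False by (auto simp: indicator_def prod_zero_iff)
qed

lemma product_sigma_finite_lborel: "product_sigma_finite (\<lambda>_. lborel :: real measure)"
  by unfold_locales

lemma integral_coord_prod:
  fixes s :: "'a::euclidean_space \<Rightarrow> real \<Rightarrow> real"
  assumes s: "\<And>c. continuous_on UNIV (s c)"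
  shows "integral (cbox p q) (coord_prod s) = (\<Prod>c\<in>Basis. integral {p \<bullet> c..q \<bullet> c} (s c))"
proof -
  interpret product_sigma_finite "\<lambda>_::'a. lborel :: real measure"
    by (rule product_sigma_finite_lborel)
  have s': "continuous_on {p \<bullet> c..q \<bullet> c} (s c)" for c
    using s continuous_on_subset by blast
  have h: "integrable lborel (\<lambda>x. indicator (cbox p q) x * coord_prod s x)"
    by (intro continuous_integrable_lborel_cbox continuous_on_coord_prod s)
  have "integral (cbox p q) (coord_prod s) = (LINT x|lborel. indicator (cbox p q) x * coord_prod s x)"
    by (intro integral_cbox_eq_lborel continuous_on_coord_prod s)
  also have "\<dots> = (\<integral>f. (\<Prod>c\<in>Basis. indicator {p \<bullet> c..q \<bullet> c} (f c) * s c (f c))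
      \<partial>(\<Pi>\<^sub>M c\<in>Basis. lborel))"
    using borel_measurable_integrable[OF h]
    by (subst lborel_integral_coordinates)
      (simp_all add: indicator_cbox_coordinates coord_prod_def prod.distrib)
  also have "\<dots> = (\<Prod>c\<in>Basis. LINT t|lborel. indicator {p \<bullet> c..q \<bullet> c} t * s c t)"
    using continuous_integrable_lborel_cbox[of "p \<bullet> c" "q \<bullet> c" "s c" for c] s'
    by (intro product_integral_prod) auto
  also have "\<dots> = (\<Prod>c\<in>Basis. integral {p \<bullet> c..q \<bullet> c} (s c))"
    using integral_cbox_eq_lborel[of "p \<bullet> c" "q \<bullet> c" "s c" for c] s' by simp
  finally show ?thesis .
qed

text \<open>Fubini's theorem in the form required for partial integration: a uniform bound on the integrals over
  all segments in direction $b$ bounds the integral over the box, with the measure of the orthogonal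
  face as an additional factor. A segment is described by its base point $y$ in the hyperplane through
  the origin orthogonal to $b$.\<close>

lemma integral_cbox_line_bound:
  fixes g :: "'a::euclidean_space \<Rightarrow> real"
  assumes g: "continuous_on (cbox p q) g" and b: "b \<in> Basis" and le: "\<And>c. c \<in> Basis \<Longrightarrow> p \<bullet> c \<le> q \<bullet> c"
    and line: "\<And>y. (\<And>t. t \<in> {p \<bullet> b..q \<bullet> b} \<Longrightarrow> y + t *\<^sub>R b \<in> cbox p q) \<Longrightarrow> y \<bullet> b = 0 \<Longrightarrow>
      \<bar>integral {p \<bullet> b..q \<bullet> b} (\<lambda>t. g (y + t *\<^sub>R b))\<bar> \<le> C"
    and C: "0 \<le> C"
  shows "\<bar>integral (cbox p q) g\<bar> \<le> C * (\<Prod>c\<in>Basis - {b}. q \<bullet> c - p \<bullet> c)"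
proof -
  interpret product_sigma_finite "\<lambda>_::'a. lborel :: real measure"
    by (rule product_sigma_finite_lborel)
  define h where "h x = indicator (cbox p q) x * g x" for x
  define B where "B = Basis - {b}"
  have Basis: "Basis = insert b B" "b \<notin> B" "finite B" using b by (auto simp: B_def)
  have h: "integrable lborel h"
    unfolding h_def by (rule continuous_integrable_lborel_cbox[OF g])
  define Y where "Y x = (\<Sum>c\<in>B. x c *\<^sub>R c)" for x :: "'a \<Rightarrow> real"
  define J where "J x = (LINT t|lborel. h (Y x + t *\<^sub>R b))" for x :: "'a \<Rightarrow> real"
  have Yb: "Y x \<bullet> b = 0" for x
    unfolding Y_def inner_sum_left using Basis b by (auto intro!: sum.neutral simp: inner_Basis B_def)
  have Yc: "Y x \<bullet> c = x c" if "c \<in> B" for x c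
  proof -
    have "Y x \<bullet> c = (\<Sum>d\<in>B. if d = c then x c else 0)"
      unfolding Y_def inner_sum_left using that by (intro sum.cong) (auto simp: inner_Basis B_def)
    then show ?thesis using that Basis by simp
  qed
  have "integral (cbox p q) g = integral\<^sup>L lborel h"
    unfolding h_def by (rule integral_cbox_eq_lborel[OF g])
  also have "\<dots> = (\<integral>f. h (\<Sum>c\<in>insert b B. f c *\<^sub>R c) \<partial>(\<Pi>\<^sub>M c\<in>insert b B. lborel))"
    using lborel_integral_coordinates[of h] borel_measurable_integrable[OF h] by (simp flip: Basis(1))
  also have "\<dots> = (\<integral>x. (\<integral>t. h (\<Sum>c\<in>insert b B. (x(b := t)) c *\<^sub>R c) \<partial>lborel) \<partial>(\<Pi>\<^sub>M c\<in>B. lborel))"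
    using lborel_integrable_coordinates[OF h] unfolding Basis(1)
    by (intro product_integral_insert Basis)
  also have "\<dots> = (\<integral>x. J x \<partial>(\<Pi>\<^sub>M c\<in>B. lborel))"
  proof -
    have "(\<Sum>c\<in>insert b B. (x(b := t)) c *\<^sub>R c) = Y x + t *\<^sub>R b" for x t
    proof -
      have "(\<Sum>c\<in>B. (x(b := t)) c *\<^sub>R c) = Y x"
        unfolding Y_def using Basis(2) by (intro sum.cong) auto
      then show ?thesis
        by (simp only: sum.insert[OF Basis(3,2)] fun_upd_same add.commute)
    qed
    then show ?thesis by (simp only: J_def)
  qed
  finally have eq: "integral (cbox p q) g = (\<integral>x. J x \<partial>(\<Pi>\<^sub>M c\<in>B. lborel))" .
  have mem: "Y x + t *\<^sub>R b \<in> cbox p q \<longleftrightarrow> t \<in> {p \<bullet> b..q \<bullet> b} \<and> (\<forall>c\<in>B. x c \<in> {p \<bullet> c..q \<bullet> c})" for x t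
  proof -
    have "b \<bullet> c = 0" if "c \<in> B" for c
      using that b by (auto simp: B_def inner_Basis)
    then show ?thesis
      unfolding mem_box Basis(1) ball_simps inner_add_left inner_scaleR_left
      using b by (auto simp: Yb Yc)
  qed
  have J: "\<bar>J x\<bar> \<le> C * (\<Prod>c\<in>B. indicator {p \<bullet> c..q \<bullet> c} (x c))" for x
  proof (cases "\<forall>c\<in>B. x c \<in> {p \<bullet> c..q \<bullet> c}")
    case True
    then have on_line: "Y x + t *\<^sub>R b \<in> cbox p q" if "t \<in> {p \<bullet> b..q \<bullet> b}" for t
      using mem that by blast
    have cont: "continuous_on {p \<bullet> b..q \<bullet> b} (\<lambda>t. g (Y x + t *\<^sub>R b))"
      by (rule continuous_on_compose2[OF g]) (use on_line in \<open>auto intro!: continuous_intros\<close>)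
    have "J x = (LINT t|lborel. indicator {p \<bullet> b..q \<bullet> b} t * g (Y x + t *\<^sub>R b))"
      unfolding J_def h_def using True by (intro Bochner_Integration.integral_cong) (auto simp: indicator_def mem)
    also have "\<dots> = integral {p \<bullet> b..q \<bullet> b} (\<lambda>t. g (Y x + t *\<^sub>R b))"
      using integral_cbox_eq_lborel[of "p \<bullet> b" "q \<bullet> b"] cont by simp
    finally have "\<bar>J x\<bar> \<le> C" using line[OF on_line Yb] by simp
    moreover have "(\<Prod>c\<in>B. indicator {p \<bullet> c..q \<bullet> c} (x c)) = (1::real)"
      using True by (intro prod.neutral) auto
    ultimately show ?thesis by simp
  next
    case False
    then have "J x = 0" unfolding J_def h_def by (simp add: mem)
    then show ?thesis using C by (simp add: prod_nonneg)
  qed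
  have ind: "integrable lborel (indicator {p \<bullet> c..q \<bullet> c} :: real \<Rightarrow> real)" for c
    by (intro integrable_real_indicator) (auto simp: emeasure_lborel_Icc_eq)
  have int: "integrable (\<Pi>\<^sub>M c\<in>B. lborel) (\<lambda>x. C * (\<Prod>c\<in>B. indicator {p \<bullet> c..q \<bullet> c} (x c)))"
    by (intro integrable_mult_right product_integrable_prod Basis ind)
  have "(\<integral>x. C * (\<Prod>c\<in>B. indicator {p \<bullet> c..q \<bullet> c} (x c)) \<partial>(\<Pi>\<^sub>M c\<in>B. lborel))
      = C * (\<Prod>c\<in>B. q \<bullet> c - p \<bullet> c)"
    using product_integral_prod[of B "\<lambda>c. indicator {p \<bullet> c..q \<bullet> c} :: real \<Rightarrow> real", OF Basis(3) ind] le
    by (auto simp: B_def intro!: prod.cong)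
  moreover have "\<bar>\<integral>x. J x \<partial>(\<Pi>\<^sub>M c\<in>B. lborel)\<bar>
      \<le> (\<integral>x. C * (\<Prod>c\<in>B. indicator {p \<bullet> c..q \<bullet> c} (x c)) \<partial>(\<Pi>\<^sub>M c\<in>B. lborel))"
    \<comment> \<open>If the inner integral were not integrable, the outer one would be 0 by convention and the
      bound would hold all the same.\<close>
  proof (cases "integrable (\<Pi>\<^sub>M c\<in>B. lborel) J")
    case True
    have "\<bar>\<integral>x. J x \<partial>(\<Pi>\<^sub>M c\<in>B. lborel)\<bar> \<le> (\<integral>x. \<bar>J x\<bar> \<partial>(\<Pi>\<^sub>M c\<in>B. lborel))"
      by (rule integral_abs_bound)
    also have "\<dots> \<le> (\<integral>x. C * (\<Prod>c\<in>B. indicator {p \<bullet> c..q \<bullet> c} (x c)) \<partial>(\<Pi>\<^sub>M c\<in>B. lborel))"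
      using True int J by (intro integral_mono) auto
    finally show ?thesis .
  next
    case False
    then show ?thesis
      using C by (simp add: not_integrable_integral_eq) (intro integral_nonneg_AE AE_I2 mult_nonneg_nonneg prod_nonneg; simp)
  qed
  ultimately show ?thesis by (simp only: eq B_def[symmetric])
qed

lemma integral_sin_mult_sin:
  assumes l: "0 < l" and mk: "m \<noteq> k" "0 < m" "0 < k"
  shows "integral {0..l} (\<lambda>t. sin (real m * pi / l * t) * sin (real k * pi / l * t)) = 0"
proof -
  define a where "a = real m * pi / l"
  define b where "b = real k * pi / l"
  have ab: "a - b \<noteq> 0" "a + b \<noteq> 0"
  proof -
    have "0 < a" "0 < b" using l mk by (simp_all add: a_def b_def)
    then show "a + b \<noteq> 0" by linarith
    show "a - b \<noteq> 0" using l mk by (simp add: a_def b_def)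
  qed
  define F where "F t = sin ((a - b) * t) / (2 * (a - b)) - sin ((a + b) * t) / (2 * (a + b))" for t
  have "(F has_vector_derivative sin (a * t) * sin (b * t)) (at t within {0..l})" for t
  proof -
    have "(F has_real_derivative cos ((a - b) * t) * (a - b) / (2 * (a - b))
        - cos ((a + b) * t) * (a + b) / (2 * (a + b))) (at t within {0..l})"
      unfolding F_def[abs_def] using ab by (auto intro!: derivative_eq_intros)
    also have "cos ((a - b) * t) * (a - b) / (2 * (a - b)) - cos ((a + b) * t) * (a + b) / (2 * (a + b))
        = cos ((a - b) * t) / 2 - cos ((a + b) * t) / 2"
      by (simp only: nonzero_mult_divide_mult_cancel_right[OF ab(1)]
          nonzero_mult_divide_mult_cancel_right[OF ab(2)])
    also have "cos ((a - b) * t) / 2 - cos ((a + b) * t) / 2 = sin (a * t) * sin (b * t)"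
      by (simp add: left_diff_distrib distrib_right sin_times_sin)
    finally show ?thesis by (simp add: has_real_derivative_iff_has_vector_derivative)
  qed
  then have "((\<lambda>t. sin (a * t) * sin (b * t)) has_integral (F l - F 0)) {0..l}"
    using l by (intro fundamental_theorem_of_calculus) auto
  moreover have "F l = 0"
  proof -
    have "(a - b) * l = of_int (int m - int k) * pi" "(a + b) * l = of_int (int m + int k) * pi"
      using l by (simp_all add: a_def b_def left_diff_distrib distrib_right)
    then have "sin ((a - b) * l) = 0" "sin ((a + b) * l) = 0"
      unfolding sin_zero_iff_int2 by blast+
    then show ?thesis by (simp only: F_def div_0 diff_self)
  qed
  moreover have "F 0 = 0" by (simp add: F_def)
  ultimately show ?thesis by (simp add: a_def b_def integral_unique)
qed

lemma sine_mode_orthogonal: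
  fixes L :: "'a::euclidean_space"
  assumes L: "\<And>c. c \<in> Basis \<Longrightarrow> 0 < L \<bullet> c"
    and pos: "\<And>c. c \<in> Basis \<Longrightarrow> 0 < m c \<and> 0 < k c" and ne: "b \<in> Basis" "m b \<noteq> k b"
  shows "L2_inner (box 0 L) (sine_mode L m) (sine_mode L k) = 0"
proof -
  define s where "s c t = sin (sine_freq L m c * t) * sin (sine_freq L k c * t)" for c t
  have "L2_inner (box 0 L) (sine_mode L m) (sine_mode L k)
      = integral (cbox 0 L) (\<lambda>x. sine_mode L m x * sine_mode L k x)"
    by (intro L2_inner_continuous continuous_on_sine_mode)
  also have "(\<lambda>x. sine_mode L m x * sine_mode L k x) = coord_prod s"
    by (simp add: sine_mode_def coord_prod_def s_def prod.distrib fun_eq_iff)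
  also have "integral (cbox 0 L) (coord_prod s) = (\<Prod>c\<in>Basis. integral {0 \<bullet> c..L \<bullet> c} (s c))"
    unfolding s_def by (intro integral_coord_prod continuous_intros)
  also have "\<dots> = 0"
  proof (rule prod_zero)
    have "integral {0 \<bullet> b..L \<bullet> b} (s b) = 0"
      using integral_sin_mult_sin[OF L[OF ne(1)] ne(2)] pos[OF ne(1)]
      by (simp add: s_def[abs_def] sine_freq_def)
    then show "\<exists>c\<in>Basis. integral {0 \<bullet> c..L \<bullet> c} (s c) = 0" using ne by blast
  qed simp
  finally show ?thesis .
qed

section \<open>Completeness of the sines\<close>

text \<open>Functions of type \<open>'a \<Rightarrow> nat\<close> carry irrelevant values outside the basis; extensionality removes
  them, so that distinct indices differ at some basis vector and give orthogonal sines.\<close>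

definition multi_indices :: "('a::euclidean_space \<Rightarrow> nat) set" where
  "multi_indices = Basis \<rightarrow>\<^sub>E {0<..}"

definition sine_span :: "'a::euclidean_space \<Rightarrow> ('a \<Rightarrow> real) set" where
  "sine_span L = {w. \<exists>F c. finite F \<and> F \<subseteq> multi_indices \<and> w = (\<lambda>x. \<Sum>m\<in>F. c m * sine_mode L m x)}"

lemma sine_span_mode: "m \<in> multi_indices \<Longrightarrow> sine_mode L m \<in> sine_span L"
  unfolding sine_span_def by (intro CollectI exI[of _ "{m}"] exI[of _ "\<lambda>_. 1"]) auto

lemma sine_span_cmult:
  assumes "w \<in> sine_span L" shows "(\<lambda>x. r * w x) \<in> sine_span L"
proof -
  obtain F c where "finite F" "F \<subseteq> multi_indices" "w = (\<lambda>x. \<Sum>m\<in>F. c m * sine_mode L m x)"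
    using assms by (auto simp: sine_span_def)
  then show ?thesis
    unfolding sine_span_def
    by (intro CollectI exI[of _ F] exI[of _ "\<lambda>m. r * c m"]) (auto simp: sum_distrib_left mult.assoc)
qed

lemma sine_span_add:
  assumes "v \<in> sine_span L" "w \<in> sine_span L" shows "(\<lambda>x. v x + w x) \<in> sine_span L"
proof -
  obtain F c where F: "finite F" "F \<subseteq> multi_indices" "v = (\<lambda>x. \<Sum>m\<in>F. c m * sine_mode L m x)"
    using assms by (auto simp: sine_span_def)
  obtain G d where G: "finite G" "G \<subseteq> multi_indices" "w = (\<lambda>x. \<Sum>m\<in>G. d m * sine_mode L m x)"
    using assms by (auto simp: sine_span_def)
  have "v x = (\<Sum>m\<in>F \<union> G. (if m \<in> F then c m else 0) * sine_mode L m x)" for x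
    unfolding F(3) using F G by (intro sum.mono_neutral_cong_left) auto
  moreover have "w x = (\<Sum>m\<in>F \<union> G. (if m \<in> G then d m else 0) * sine_mode L m x)" for x
    unfolding G(3) using F G by (intro sum.mono_neutral_cong_left) auto
  ultimately have "(\<lambda>x. v x + w x) = (\<lambda>x. \<Sum>m\<in>F \<union> G.
      ((if m \<in> F then c m else 0) + (if m \<in> G then d m else 0)) * sine_mode L m x)"
    by (simp add: distrib_right sum.distrib)
  then show ?thesis
    unfolding sine_span_def using F G
    by (intro CollectI exI[of _ "F \<union> G"]
        exI[of _ "\<lambda>m. (if m \<in> F then c m else 0) + (if m \<in> G then d m else 0)"]) auto
qed

lemma sine_span_zero: "(\<lambda>x. 0) \<in> sine_span L"
  unfolding sine_span_def by (intro CollectI exI[of _ "{}"]) auto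

lemma sine_span_sum:
  assumes "finite F" "\<And>i. i \<in> F \<Longrightarrow> w i \<in> sine_span L"
  shows "(\<lambda>x. \<Sum>i\<in>F. w i x) \<in> sine_span L"
  using assms by (induction F rule: finite_induct) (auto intro: sine_span_zero sine_span_add)

lemma sine_mode_update:
  assumes "b \<in> Basis"
  shows "sine_mode L (m(b := j)) x = sin (real j * pi / (L \<bullet> b) * (x \<bullet> b))
    * (\<Prod>c\<in>Basis - {b}. sin (sine_freq L m c * (x \<bullet> c)))"
proof -
  have "sine_mode L (m(b := j))
      = coord_prod ((\<lambda>c t. sin (sine_freq L m c * t))(b := \<lambda>t. sin (real j * pi / (L \<bullet> b) * t)))"
    unfolding sine_mode_def by (intro arg_cong[of _ _ coord_prod]) (auto simp: sine_freq_def fun_eq_iff)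
  then show ?thesis by (simp only: coord_prod_update[OF assms])
qed

text \<open>The product-to-sum formula $2 \cos\theta \sin k\theta = \sin (k+1)\theta + \sin (k-1)\theta$. For
  $k = 1$ the last term is zero.\<close>

lemma cos_mult_sine_mode:
  assumes b: "b \<in> Basis" and m: "0 < m b"
  shows "cos (pi / (L \<bullet> b) * (x \<bullet> b)) * sine_mode L m x
    = 1/2 * sine_mode L (m(b := m b + 1)) x + 1/2 * sine_mode L (m(b := m b - 1)) x"
proof -
  define \<theta> where "\<theta> = pi / (L \<bullet> b) * (x \<bullet> b)"
  define P where "P = (\<Prod>c\<in>Basis - {b}. sin (sine_freq L m c * (x \<bullet> c)))"
  have mode: "sine_mode L (m(b := j)) x = sin (real j * \<theta>) * P" for j
    unfolding sine_mode_update[OF b] \<theta>_def P_def by (simp add: mult.assoc)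
  have m_mode: "sine_mode L m x = sin (real (m b) * \<theta>) * P"
    using mode[of "m b"] by simp
  define A where "A = sin (real (m b + 1) * \<theta>)"
  define B where "B = sin (real (m b - 1) * \<theta>)"
  have sum: "cos \<theta> * sin (real (m b) * \<theta>) = (A + B) / 2"
    using m by (simp add: A_def B_def of_nat_diff left_diff_distrib distrib_right sin_add sin_diff)
  have "cos \<theta> * (sin (real (m b) * \<theta>) * P) = 1/2 * (A * P) + 1/2 * (B * P)"
    unfolding mult.assoc[symmetric] sum by (simp add: add_divide_distrib distrib_right)
  then show ?thesis
    unfolding mode m_mode \<theta>_def[symmetric] A_def B_def .
qed

lemma cos_mult_sine_span:
  assumes b: "b \<in> Basis" and w: "w \<in> sine_span L"
  shows "(\<lambda>x. cos (pi / (L \<bullet> b) * (x \<bullet> b)) * w x) \<in> sine_span L"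
proof -
  have mode: "(\<lambda>x. cos (pi / (L \<bullet> b) * (x \<bullet> b)) * sine_mode L m x) \<in> sine_span L"
    if m: "m \<in> multi_indices" for m
  proof -
    have mb: "0 < m b" using m b by (auto simp: multi_indices_def)
    have upd: "m(b := j) \<in> multi_indices" if "0 < j" for j
      using m b that unfolding multi_indices_def by (auto simp: PiE_iff extensional_def)
    have lower: "sine_mode L (m(b := m b - 1)) \<in> sine_span L"
    proof (cases "m b = 1")
      case True
      then have "sine_mode L (m(b := m b - 1)) = (\<lambda>x. 0)"
        by (simp add: sine_mode_update[OF b] fun_eq_iff del: fun_upd_apply)
      then show ?thesis by (simp add: sine_span_zero)
    next
      case False
      then show ?thesis using mb by (intro sine_span_mode upd) simp
    qed
    show ?thesis
      unfolding cos_mult_sine_mode[of b m, OF b mb]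
      by (rule sine_span_add[OF sine_span_cmult[OF sine_span_mode[OF upd]] sine_span_cmult[OF lower]]) simp
  qed
  obtain F c where F: "finite F" "F \<subseteq> multi_indices" "w = (\<lambda>x. \<Sum>m\<in>F. c m * sine_mode L m x)"
    using w by (auto simp: sine_span_def)
  have "(\<lambda>x. \<Sum>m\<in>F. c m * (cos (pi / (L \<bullet> b) * (x \<bullet> b)) * sine_mode L m x)) \<in> sine_span L"
    using F by (intro sine_span_sum sine_span_cmult mode) auto
  then show ?thesis unfolding F(3) by (simp add: sum_distrib_left mult.left_commute)
qed

lemma continuous_on_sine_span:
  assumes "w \<in> sine_span L" shows "continuous_on S w"
  using assms by (auto simp: sine_span_def intro!: continuous_intros continuous_on_sine_mode)

text \<open>The span of the sines is not an algebra and all its members vanish on the boundary, so the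
  Stone-Weierstrass theorem does not apply to it. It is applied to the algebra of multipliers of the
  span instead.\<close>

definition sine_span_multipliers :: "'a::euclidean_space \<Rightarrow> ('a \<Rightarrow> real) set" where
  "sine_span_multipliers L = {p. continuous_on UNIV p \<and> (\<forall>w\<in>sine_span L. (\<lambda>x. p x * w x) \<in> sine_span L)}"

text \<open>The functions $\cos(\pi x_c/L_c)$ are multipliers, and they separate the points of the closed box
  because the cosine is injective on $[0,\pi]$.\<close>

lemma multipliers_function_ring:
  fixes L :: "'a::euclidean_space"
  assumes L: "\<And>c. c \<in> Basis \<Longrightarrow> 0 < L \<bullet> c"
  shows "function_ring_on (sine_span_multipliers L) (cbox 0 L)"
proof
  show "compact (cbox 0 L)" by (rule compact_cbox)
  fix p q assume p: "p \<in> sine_span_multipliers L" 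
  show "continuous_on (cbox 0 L) p"
    using p continuous_on_subset[OF _ subset_UNIV] unfolding sine_span_multipliers_def by blast
  assume q: "q \<in> sine_span_multipliers L"
  show "(\<lambda>x. p x + q x) \<in> sine_span_multipliers L" "(\<lambda>x. p x * q x) \<in> sine_span_multipliers L"
  proof -
    have cont: "continuous_on UNIV p" "continuous_on UNIV q"
      and pw: "(\<lambda>x. p x * w x) \<in> sine_span L" and qw: "(\<lambda>x. q x * w x) \<in> sine_span L"
      if "w \<in> sine_span L" for w
      using p q that unfolding sine_span_multipliers_def by blast+
    have "(\<lambda>x. (p x + q x) * w x) \<in> sine_span L" "(\<lambda>x. (p x * q x) * w x) \<in> sine_span L"
      if w: "w \<in> sine_span L" for w
      unfolding distrib_right mult.assoc by (rule sine_span_add[OF pw[OF w] qw[OF w]], rule pw[OF qw[OF w]])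
    moreover have "continuous_on UNIV (\<lambda>x. p x + q x)" "continuous_on UNIV (\<lambda>x. p x * q x)"
      by (intro continuous_intros cont[OF sine_span_zero])+
    ultimately show "(\<lambda>x. p x + q x) \<in> sine_span_multipliers L"
      "(\<lambda>x. p x * q x) \<in> sine_span_multipliers L"
      unfolding sine_span_multipliers_def by blast+
  qed
next
  show "(\<lambda>_. c) \<in> sine_span_multipliers L" for c
    by (simp add: sine_span_multipliers_def sine_span_cmult)
next
  fix x y :: 'a assume xy: "x \<in> cbox 0 L" "y \<in> cbox 0 L" "x \<noteq> y"
  then obtain b where b: "b \<in> Basis" "x \<bullet> b \<noteq> y \<bullet> b" using euclidean_eqI by blast
  define \<theta> where "\<theta> z = pi / (L \<bullet> b) * (z \<bullet> b)" for z
  have l: "0 < L \<bullet> b" by (rule L[OF b(1)])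
  have range: "0 \<le> \<theta> z" "\<theta> z \<le> pi" if "z \<in> cbox 0 L" for z
  proof -
    have z: "0 \<le> z \<bullet> b" "z \<bullet> b \<le> L \<bullet> b" using that b(1) by (auto simp: mem_box)
    show "0 \<le> \<theta> z" unfolding \<theta>_def using l z(1) by simp
    have "\<theta> z \<le> pi / (L \<bullet> b) * (L \<bullet> b)"
      unfolding \<theta>_def by (rule mult_left_mono[OF z(2)]) (use l in simp)
    then show "\<theta> z \<le> pi" using l by simp
  qed
  have "cos (\<theta> x) \<noteq> cos (\<theta> y)"
  proof
    assume "cos (\<theta> x) = cos (\<theta> y)"
    then have "\<theta> x = \<theta> y"
      by (rule cos_inj_pi[OF range(1)[OF xy(1)] range(2)[OF xy(1)] range(1)[OF xy(2)] range(2)[OF xy(2)]])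
    then show False using b(2) l by (simp add: \<theta>_def)
  qed
  moreover have "(\<lambda>z. cos (\<theta> z)) \<in> sine_span_multipliers L"
  proof -
    have "continuous_on UNIV (\<lambda>z. cos (\<theta> z))"
      unfolding \<theta>_def by (intro continuous_intros)
    then show ?thesis
      using cos_mult_sine_span[OF b(1)] by (simp add: sine_span_multipliers_def \<theta>_def)
  qed
  ultimately show "\<exists>p\<in>sine_span_multipliers L. p x \<noteq> p y"
    by (intro bexI[of _ "\<lambda>z. cos (\<theta> z)"])
qed

lemma abs_sine_mode_le_1: "\<bar>sine_mode L m x\<bar> \<le> 1"
  unfolding sine_mode_def coord_prod_def abs_prod by (intro prod_le_1) auto

definition ground_index :: "'a::euclidean_space \<Rightarrow> nat" where
  "ground_index = restrict (\<lambda>_. 1) Basis"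

lemma ground_index: "ground_index \<in> multi_indices" "c \<in> Basis \<Longrightarrow> ground_index c = 1"
  by (auto simp: ground_index_def multi_indices_def)

lemma sine_mode_ground_pos:
  fixes L :: "'a::euclidean_space"
  assumes L: "\<And>c. c \<in> Basis \<Longrightarrow> 0 < L \<bullet> c" and x: "x \<in> box 0 L"
  shows "0 < sine_mode L ground_index x"
  unfolding sine_mode_def coord_prod_def
proof (rule prod_pos)
  fix c :: 'a assume c: "c \<in> Basis"
  have "0 < x \<bullet> c" "x \<bullet> c < L \<bullet> c" using x c by (auto simp: mem_box)
  then show "0 < sin (sine_freq L ground_index c * (x \<bullet> c))"
    using c L[OF c] by (intro sin_gt_zero) (auto simp: sine_freq_def ground_index field_simps)
qed

text \<open>The square of the $L^2$ distance, which obeys the triangle inequality only up to a factor 2.\<close>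

definition L2_dist :: "'a::euclidean_space set \<Rightarrow> ('a \<Rightarrow> real) \<Rightarrow> ('a \<Rightarrow> real) \<Rightarrow> real" where
  "L2_dist S f g = (LINT x|lebesgue_on S. (f x - g x)\<^sup>2)"

lemma L2_dist_triangle:
  assumes f: "f \<in> L2_on S" and g: "g \<in> L2_on S" and h: "h \<in> L2_on S"
  shows "L2_dist S f h \<le> 2 * L2_dist S f g + 2 * L2_dist S g h"
proof -
  have int: "integrable (lebesgue_on S) (\<lambda>x. (u x - v x)\<^sup>2)" if "u \<in> L2_on S" "v \<in> L2_on S" for u v
    using L2_diff[OF that] by (simp add: L2_on_def)
  have "(a - c)\<^sup>2 \<le> 2 * (a - b)\<^sup>2 + 2 * (b - c)\<^sup>2" for a b c :: real
  proof -
    have "2 * (a - b)\<^sup>2 + 2 * (b - c)\<^sup>2 - (a - c)\<^sup>2 = (a - 2 * b + c)\<^sup>2"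
      by (simp add: power2_eq_square algebra_simps)
    then show ?thesis by (metis diff_ge_0_iff_ge zero_le_power2)
  qed
  then have "L2_dist S f h \<le> (LINT x|lebesgue_on S. 2 * (f x - g x)\<^sup>2 + 2 * (g x - h x)\<^sup>2)"
    unfolding L2_dist_def using int f g h by (intro integral_mono Bochner_Integration.integrable_add integrable_mult_right) auto
  also have "\<dots> = 2 * L2_dist S f g + 2 * L2_dist S g h"
    unfolding L2_dist_def using int f g h by simp
  finally show ?thesis .
qed

text \<open>Write $f = s q$ with the ground state $s$, which is positive in the box, and truncate $q$ at height
  $n$. The error is dominated by $|f|$ and tends to 0 pointwise.\<close>

lemma approx_clipped:
  fixes L :: "'a::euclidean_space"
  assumes L: "\<And>c. c \<in> Basis \<Longrightarrow> 0 < L \<bullet> c" and f: "f \<in> L2_on (box 0 L)" and e: "0 < e"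
  defines "s \<equiv> sine_mode L ground_index"
  shows "\<exists>g n. g \<in> borel_measurable (lebesgue_on (box 0 L)) \<and> (\<forall>x. \<bar>g x\<bar> \<le> real n)
    \<and> L2_dist (box 0 L) f (\<lambda>x. s x * g x) < e"
proof -
  let ?M = "lebesgue_on (box 0 L)"
  define q where "q x = f x / s x" for x
  define g where "g n x = max (- real n) (min (real n) (q x))" for n x
  have s_meas: "s \<in> borel_measurable ?M"
    unfolding s_def by (rule L2_measurable[OF L2_continuous[OF continuous_on_sine_mode]])
  have q: "q \<in> borel_measurable ?M"
    unfolding q_def using f s_meas by measurable
  have g: "g n \<in> borel_measurable ?M" for n
    unfolding g_def using q by measurable
  have spos: "0 < s x" if "x \<in> box 0 L" for x
    unfolding s_def by (rule sine_mode_ground_pos[OF L that])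
  have "(\<lambda>n. LINT x|?M. (f x - s x * g n x)\<^sup>2) \<longlonglongrightarrow> (LINT x|?M. 0)"
  proof (rule integral_dominated_convergence)
    show "integrable ?M (\<lambda>x. (f x)\<^sup>2)" using f by (simp add: L2_on_def)
    show "(\<lambda>x. (f x - s x * g n x)\<^sup>2) \<in> borel_measurable ?M" for n
      using f s_meas g by measurable
    show "AE x in ?M. (\<lambda>n. (f x - s x * g n x)\<^sup>2) \<longlonglongrightarrow> 0"
    proof (intro AE_I2 tendsto_eventually)
      fix x assume "x \<in> space ?M"
      then have "0 < s x" using spos by simp
      obtain N where "\<bar>q x\<bar> \<le> real N" using real_arch_simple by blast
      then have "g n x = q x" if "N \<le> n" for n
        using that by (auto simp: g_def)
      then have "(f x - s x * g n x)\<^sup>2 = 0" if "N \<le> n" for n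
        using that \<open>0 < s x\<close> by (simp add: q_def)
      then show "eventually (\<lambda>n. (f x - s x * g n x)\<^sup>2 = 0) sequentially"
        by (auto simp: eventually_sequentially)
    qed
    show "AE x in ?M. norm ((f x - s x * g n x)\<^sup>2) \<le> (f x)\<^sup>2" for n
    proof (rule AE_I2)
      fix x assume "x \<in> space ?M"
      then have "0 < s x" using spos by simp
      then have "f x = s x * q x" by (simp add: q_def)
      then have "\<bar>f x - s x * g n x\<bar> = s x * \<bar>q x - g n x\<bar>"
        using \<open>0 < s x\<close> by (simp add: abs_mult flip: right_diff_distrib)
      also have "\<dots> \<le> s x * \<bar>q x\<bar>"
        using \<open>0 < s x\<close> by (intro mult_left_mono) (auto simp: g_def)
      also have "\<dots> = \<bar>f x\<bar>" using \<open>0 < s x\<close> \<open>f x = s x * q x\<close> by (simp add: abs_mult)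
      finally show "norm ((f x - s x * g n x)\<^sup>2) \<le> (f x)\<^sup>2"
        by (simp add: abs_le_square_iff)
    qed
  qed simp
  then have "(\<lambda>n. L2_dist (box 0 L) f (\<lambda>x. s x * g n x)) \<longlonglongrightarrow> 0" by (simp add: L2_dist_def)
  from order_tendstoD(2)[OF this e] obtain n where "L2_dist (box 0 L) f (\<lambda>x. s x * g n x) < e"
    unfolding eventually_sequentially by blast
  moreover have "\<forall>x. \<bar>g n x\<bar> \<le> real n" by (auto simp: g_def)
  ultimately show ?thesis using g by blast
qed

text \<open>A measurable function is the pointwise limit almost everywhere of continuous functions. Truncating
  them at the height $n$ that bounds $g$ supplies a constant as dominating function.\<close>

lemma approx_continuous:
  fixes L :: "'a::euclidean_space"
  assumes g: "g \<in> borel_measurable (lebesgue_on (box 0 L))" and bound: "\<And>x. \<bar>g x\<bar> \<le> real n"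
    and e: "0 < e"
  defines "s \<equiv> sine_mode L ground_index"
  shows "\<exists>h. continuous_on UNIV h \<and> L2_dist (box 0 L) (\<lambda>x. s x * g x) (\<lambda>x. s x * h x) < e"
proof -
  let ?M = "lebesgue_on (box 0 L)"
  have "g measurable_on (box 0 L)"
    using g by (simp add: measurable_on_iff_borel_measurable)
  then obtain N u where N: "negligible N" and u: "\<And>k. continuous_on UNIV (u k)"
    and lim: "\<And>x. x \<notin> N \<Longrightarrow> (\<lambda>k. u k x) \<longlonglongrightarrow> (if x \<in> box 0 L then g x else 0)"
    by (auto simp: measurable_on_def)
  define h where "h k x = max (- real n) (min (real n) (u k x))" for k x
  have h: "continuous_on UNIV (h k)" for k
    unfolding h_def by (intro continuous_intros u)
  have s_meas: "s \<in> borel_measurable ?M"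
    unfolding s_def by (rule L2_measurable[OF L2_continuous[OF continuous_on_sine_mode]])
  have h_meas: "h k \<in> borel_measurable ?M" for k
    by (rule L2_measurable[OF L2_continuous[OF continuous_on_subset[OF h subset_UNIV]]])
  have "(\<lambda>k. LINT x|?M. (s x * g x - s x * h k x)\<^sup>2) \<longlonglongrightarrow> (LINT x|?M. 0)"
  proof (rule integral_dominated_convergence)
    show "integrable ?M (\<lambda>x. (2 * real n)\<^sup>2)" by (intro integrable_lebesgue_on_box continuous_intros)
    show "(\<lambda>x. (s x * g x - s x * h k x)\<^sup>2) \<in> borel_measurable ?M" for k
      using s_meas h_meas g by measurable
    have "AE x in lebesgue. x \<notin> N"
      using N by (auto simp: eventually_ae_filter_negligible)
    then have "AE x in ?M. x \<notin> N"
      by (subst AE_restrict_space_iff) (auto elim: eventually_mono)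
    then show "AE x in ?M. (\<lambda>k. (s x * g x - s x * h k x)\<^sup>2) \<longlonglongrightarrow> 0"
    proof (rule AE_mp, intro AE_I2 impI)
      fix x assume "x \<in> space ?M" "x \<notin> N"
      then have "(\<lambda>k. u k x) \<longlonglongrightarrow> g x" using lim[of x] by simp
      then have "(\<lambda>k. h k x) \<longlonglongrightarrow> max (- real n) (min (real n) (g x))"
        unfolding h_def by (intro tendsto_max tendsto_min tendsto_const)
      moreover have "max (- real n) (min (real n) (g x)) = g x" using bound[of x] by auto
      ultimately have "(\<lambda>k. (s x * g x - s x * h k x)\<^sup>2) \<longlonglongrightarrow> (s x * g x - s x * g x)\<^sup>2"
        by (intro tendsto_intros) simp
      then show "(\<lambda>k. (s x * g x - s x * h k x)\<^sup>2) \<longlonglongrightarrow> 0" by simp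
    qed
    show "AE x in ?M. norm ((s x * g x - s x * h k x)\<^sup>2) \<le> (2 * real n)\<^sup>2" for k
    proof (rule AE_I2)
      fix x
      have "\<bar>s x * g x - s x * h k x\<bar> = \<bar>s x\<bar> * \<bar>g x - h k x\<bar>"
        by (simp add: abs_mult flip: right_diff_distrib)
      also have "\<dots> \<le> 1 * (2 * real n)"
        using bound[of x] by (intro mult_mono) (auto simp: h_def s_def abs_sine_mode_le_1)
      finally show "norm ((s x * g x - s x * h k x)\<^sup>2) \<le> (2 * real n)\<^sup>2"
        using abs_le_square_iff[of "s x * g x - s x * h k x" "2 * real n"] by simp
    qed
  qed simp
  then have "(\<lambda>k. L2_dist (box 0 L) (\<lambda>x. s x * g x) (\<lambda>x. s x * h k x)) \<longlonglongrightarrow> 0"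
    by (simp add: L2_dist_def)
  from order_tendstoD(2)[OF this e]
  obtain k where "L2_dist (box 0 L) (\<lambda>x. s x * g x) (\<lambda>x. s x * h k x) < e"
    unfolding eventually_sequentially by blast
  then show ?thesis using h by blast
qed

text \<open>If $p$ is a multiplier of the span with $|h - p| < \delta$ on the closed box, then $p s$ lies in the
  span and $|s h - p s| < \delta$, since $|s| \le 1$.\<close>

lemma approx_sine_span:
  fixes L :: "'a::euclidean_space"
  assumes L: "\<And>c. c \<in> Basis \<Longrightarrow> 0 < L \<bullet> c" and h: "continuous_on UNIV h" and e: "0 < e"
  defines "s \<equiv> sine_mode L ground_index"
  shows "\<exists>w\<in>sine_span L. L2_dist (box 0 L) (\<lambda>x. s x * h x) w < e"
proof -
  interpret function_ring_on "sine_span_multipliers L" "cbox 0 L"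
    by (rule multipliers_function_ring[OF L])
  define V where "V = integral (cbox 0 L) (\<lambda>x::'a. 1::real)"
  have V: "0 \<le> V" unfolding V_def by (intro integral_nonneg) (auto intro: integrable_on_const)
  define \<delta> where "\<delta> = sqrt (e / (V + 1))"
  have \<delta>: "0 < \<delta>" using e V by (simp add: \<delta>_def)
  obtain p where p: "p \<in> sine_span_multipliers L" and app: "\<And>x. x \<in> cbox 0 L \<Longrightarrow> \<bar>h x - p x\<bar> < \<delta>"
    using Stone_Weierstrass_basic[OF continuous_on_subset[OF h subset_UNIV] \<delta>] by blast
  have w: "(\<lambda>x. p x * s x) \<in> sine_span L"
    using p sine_span_mode[OF ground_index(1), of L] by (auto simp: sine_span_multipliers_def s_def)
  have cs: "continuous_on A s" for A unfolding s_def by (rule continuous_on_sine_mode)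
  have cont: "continuous_on (cbox 0 L) (\<lambda>x. (s x * h x - p x * s x)\<^sup>2)"
    by (intro continuous_intros cs continuous_on_subset[OF h subset_UNIV] continuous[OF p])
  have "L2_dist (box 0 L) (\<lambda>x. s x * h x) (\<lambda>x. p x * s x)
      = integral (cbox 0 L) (\<lambda>x. (s x * h x - p x * s x)\<^sup>2)"
    unfolding L2_dist_def by (rule lebesgue_integral_box[OF cont])
  also have "\<dots> \<le> integral (cbox 0 L) (\<lambda>x. \<delta>\<^sup>2 * 1)"
  proof (rule integral_le)
    show "(\<lambda>x. (s x * h x - p x * s x)\<^sup>2) integrable_on cbox 0 L"
      by (rule integrable_continuous[OF cont])
    fix x assume x: "x \<in> cbox 0 L"
    have "\<bar>s x * h x - p x * s x\<bar> = \<bar>s x\<bar> * \<bar>h x - p x\<bar>"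
      by (simp add: abs_mult mult.commute[of "p x"] flip: right_diff_distrib)
    also have "\<dots> \<le> 1 * \<delta>"
      using app[OF x] by (intro mult_mono) (auto simp: s_def abs_sine_mode_le_1)
    finally show "(s x * h x - p x * s x)\<^sup>2 \<le> \<delta>\<^sup>2 * 1"
      using abs_le_square_iff[of "s x * h x - p x * s x" \<delta>] \<delta> by simp
  qed (intro integrable_continuous continuous_intros)
  also have "\<dots> = \<delta>\<^sup>2 * V" by (simp only: integral_mult_right V_def)
  also have "\<dots> < e" using e V by (simp add: \<delta>_def field_simps)
  finally show ?thesis using w by blast
qed

lemma sine_span_dense:
  fixes L :: "'a::euclidean_space"
  assumes L: "\<And>c. c \<in> Basis \<Longrightarrow> 0 < L \<bullet> c" and f: "f \<in> L2_on (box 0 L)" and e: "0 < e"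
  shows "\<exists>w\<in>sine_span L. L2_dist (box 0 L) f w < e"
proof -
  let ?S = "box 0 L" and ?s = "sine_mode L ground_index"
  have e8: "0 < e / 16" using e by simp
  obtain g n where g: "g \<in> borel_measurable (lebesgue_on ?S)" "\<And>x. \<bar>g x\<bar> \<le> real n"
    and 1: "L2_dist ?S f (\<lambda>x. ?s x * g x) < e / 16"
    using approx_clipped[OF L f e8] by blast
  obtain h where h: "continuous_on UNIV h" and 2: "L2_dist ?S (\<lambda>x. ?s x * g x) (\<lambda>x. ?s x * h x) < e / 16"
    using approx_continuous[OF g e8] by blast
  obtain w where w: "w \<in> sine_span L" and 3: "L2_dist ?S (\<lambda>x. ?s x * h x) w < e / 16"
    using approx_sine_span[OF L h e8] by blast
  have L2: "(\<lambda>x. ?s x * h x) \<in> L2_on ?S" "w \<in> L2_on ?S"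
    by (intro L2_continuous continuous_intros continuous_on_sine_mode continuous_on_subset[OF h] subset_UNIV
        continuous_on_sine_span[OF w])+
  have meas: "(\<lambda>x. ?s x * g x) \<in> borel_measurable (lebesgue_on ?S)"
    using L2_measurable[OF L2_continuous[OF continuous_on_sine_mode]] g(1) by measurable
  have sg: "(\<lambda>x. ?s x * g x) \<in> L2_on ?S"
    unfolding L2_on_def
  proof (intro CollectI conjI meas)
    show "integrable (lebesgue_on ?S) (\<lambda>x. (?s x * g x)\<^sup>2)"
    proof (rule Bochner_Integration.integrable_bound)
      show "integrable (lebesgue_on ?S) (\<lambda>x. (real n)\<^sup>2)"
        by (intro integrable_lebesgue_on_box continuous_intros)
      show "(\<lambda>x. (?s x * g x)\<^sup>2) \<in> borel_measurable (lebesgue_on ?S)" using meas by measurable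
      have "\<bar>?s x * g x\<bar> \<le> 1 * real n" for x
        unfolding abs_mult using g(2) by (intro mult_mono) (auto simp: abs_sine_mode_le_1)
      then have "(?s x * g x)\<^sup>2 \<le> (real n)\<^sup>2" for x
        using abs_le_square_iff[of "?s x * g x" "real n"] by simp
      then show "AE x in lebesgue_on ?S. norm ((?s x * g x)\<^sup>2) \<le> norm ((real n)\<^sup>2)" by simp
    qed
  qed
  have "L2_dist ?S f w \<le> 2 * L2_dist ?S f (\<lambda>x. ?s x * g x) + 2 * L2_dist ?S (\<lambda>x. ?s x * g x) w"
    by (rule L2_dist_triangle[OF f sg L2(2)])
  moreover have "L2_dist ?S (\<lambda>x. ?s x * g x) w
      \<le> 2 * L2_dist ?S (\<lambda>x. ?s x * g x) (\<lambda>x. ?s x * h x) + 2 * L2_dist ?S (\<lambda>x. ?s x * h x) w"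
    by (rule L2_dist_triangle[OF sg L2])
  ultimately have "L2_dist ?S f w < e" using 1 2 3 e by linarith
  then show ?thesis using w by blast
qed

definition index_enum :: "nat \<Rightarrow> 'a::euclidean_space \<Rightarrow> nat" where
  "index_enum = from_nat_into multi_indices"

text \<open>A basis is a sequence by definition, so the multi-indices have to be enumerated by the natural
  numbers. There are infinitely many because the basis is nonempty.\<close>

lemma bij_index_enum: "bij_betw index_enum UNIV (multi_indices :: ('a::euclidean_space \<Rightarrow> nat) set)"
  unfolding index_enum_def
proof (rule bij_betw_from_nat_into)
  show "countable (multi_indices :: ('a \<Rightarrow> nat) set)"
    unfolding multi_indices_def by (intro countable_PiE) auto
  let ?j = "\<lambda>k. restrict (\<lambda>_. Suc k) Basis :: 'a \<Rightarrow> nat"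
  have "inj ?j"
  proof (rule injI)
    fix k l assume "?j k = ?j l"
    moreover obtain b :: 'a where "b \<in> Basis" using nonempty_Basis by blast
    ultimately show "k = l" by (metis nat.inject restrict_apply')
  qed
  moreover have "range ?j \<subseteq> multi_indices" by (auto simp: multi_indices_def)
  ultimately show "infinite (multi_indices :: ('a \<Rightarrow> nat) set)"
    using finite_subset range_inj_infinite by blast
qed

lemma sine_eigenbasis:
  fixes L :: "'a::euclidean_space"
  assumes L: "\<And>c. c \<in> Basis \<Longrightarrow> 0 < L \<bullet> c"
  shows "dirichlet_eigenbasis (box 0 L) (\<lambda>k. box_eigenvalue L (index_enum k)) (\<lambda>k. sine_mode L (index_enum k))"
  unfolding dirichlet_eigenbasis_def
proof (intro conjI allI)
  have mem: "index_enum k \<in> (multi_indices :: ('a \<Rightarrow> nat) set)" for k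
    using bij_betwE[OF bij_index_enum] by blast
  then have pos: "0 < (index_enum k :: 'a \<Rightarrow> nat) c" if "c \<in> Basis" for k c
    using that mem[of k] by (auto simp: multi_indices_def)
  show "dirichlet_eigenfunction (box 0 L) (box_eigenvalue L (index_enum k)) (sine_mode L (index_enum k))" for k
    by (intro sine_mode_dirichlet L pos)
  show "L2_orthogonal_basis (box 0 L) (\<lambda>k. sine_mode L (index_enum k))"
  proof (rule dense_orthogonal_imp_basis)
    show L2: "sine_mode L (index_enum k) \<in> L2_on (box 0 L)" for k
      by (intro L2_continuous continuous_on_sine_mode)
    show "L2_inner (box 0 L) (sine_mode L (index_enum k)) (sine_mode L (index_enum k)) \<noteq> 0" for k
    proof -
      obtain x where "x \<in> box 0 L" "sine_mode L (index_enum k) x \<noteq> 0"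
        using sine_mode_nonzero[OF L, of "index_enum k"] pos by blast
      then show ?thesis
        by (intro L2_inner_pos_of_continuous[OF open_box continuous_on_sine_mode L2])
    qed
    show "L2_inner (box 0 L) (sine_mode L (index_enum k)) (sine_mode L (index_enum l)) = 0"
      if "k \<noteq> l" for k l
    proof -
      have "index_enum k \<noteq> (index_enum l :: 'a \<Rightarrow> nat)"
        using that bij_index_enum by (metis UNIV_I bij_betw_inv_into_left)
      then obtain b :: 'a where "b \<in> Basis" "index_enum k b \<noteq> index_enum l b"
        using PiE_ext[OF mem[of k, unfolded multi_indices_def] mem[of l, unfolded multi_indices_def]] by blast
      then show ?thesis using L pos by (intro sine_mode_orthogonal) auto
    qed
    fix f e assume f: "f \<in> L2_on (box 0 L)" and e: "0 < (e::real)"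
    obtain F c where F: "finite F" "F \<subseteq> multi_indices"
      and d: "L2_dist (box 0 L) f (\<lambda>x. \<Sum>m\<in>F. c m * sine_mode L m x) < e"
      using sine_span_dense[OF L f e] by (auto simp: sine_span_def)
    define G where "G = index_enum -` F"
    have inj: "inj (index_enum :: nat \<Rightarrow> 'a \<Rightarrow> nat)" using bij_index_enum by (auto simp: bij_betw_def)
    have img: "index_enum ` G = F"
      unfolding G_def using F(2) bij_index_enum by (auto simp: bij_betw_def)
    have "finite G" unfolding G_def by (intro finite_vimageI F inj)
    moreover have "(\<Sum>m\<in>F. c m * sine_mode L m x) = (\<Sum>k\<in>G. c (index_enum k) * sine_mode L (index_enum k) x)" for x
      unfolding img[symmetric] by (subst sum.reindex) (auto intro: inj_on_subset[OF inj])
    ultimately show "\<exists>F c. finite F \<and> L2_inner (box 0 L)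
        (\<lambda>x. f x - (\<Sum>m\<in>F. c m * sine_mode L (index_enum m) x))
        (\<lambda>x. f x - (\<Sum>m\<in>F. c m * sine_mode L (index_enum m) x)) < e"
      using d by (intro exI[of _ G] exI[of _ "\<lambda>k. c (index_enum k)"])
        (simp add: L2_dist_def L2_inner_def power2_eq_square)
  qed
qed

section \<open>The classical Dirichlet spectrum of a box\<close>

text \<open>The derivative along a segment whose direction is a multiple $r b$ of $b$: this is how the dilation
  below enters the chain rule.\<close>

lemma line_derivative:
  fixes f :: "'a::euclidean_space \<Rightarrow> real"
  assumes "f differentiable at (p + t *\<^sub>R (r *\<^sub>R b))"
  shows "((\<lambda>t. f (p + t *\<^sub>R (r *\<^sub>R b))) has_real_derivative
    r * partial_derivative b f (p + t *\<^sub>R (r *\<^sub>R b))) (at t within A)"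
proof -
  define D where "D = frechet_derivative f (at (p + t *\<^sub>R (r *\<^sub>R b)))"
  have D: "(f has_derivative D) (at (p + t *\<^sub>R (r *\<^sub>R b)))"
    using assms unfolding D_def frechet_derivative_works .
  have "((\<lambda>t. p + t *\<^sub>R (r *\<^sub>R b)) has_derivative (\<lambda>h. h *\<^sub>R (r *\<^sub>R b))) (at t within A)"
    by (auto intro!: derivative_eq_intros)
  from has_derivative_compose[OF this D]
  have "((\<lambda>t. f (p + t *\<^sub>R (r *\<^sub>R b))) has_derivative (\<lambda>h. D (h *\<^sub>R (r *\<^sub>R b)))) (at t within A)" .
  moreover have "D (h *\<^sub>R (r *\<^sub>R b)) = (r * D b) * h" for h
    using has_derivative_linear[OF D] by (simp add: linear_scale)
  ultimately show ?thesis
    by (simp add: has_field_derivative_def D_def partial_derivative_def)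
qed

text \<open>The homothety with ratio $r$ about the centre $L/2$ of the box. For $r < 1$ it maps the closed box
  into the open one.\<close>

definition contract :: "'a::euclidean_space \<Rightarrow> real \<Rightarrow> 'a \<Rightarrow> 'a" where
  "contract L r x = (1/2) *\<^sub>R L + r *\<^sub>R (x - (1/2) *\<^sub>R L)"

lemma contract_line: "contract L r (y + t *\<^sub>R b) = contract L r y + t *\<^sub>R (r *\<^sub>R b)"
  by (simp add: contract_def algebra_simps)

lemma continuous_on_contract [continuous_intros]: "continuous_on S (contract L r)"
  unfolding contract_def by (intro continuous_intros)

lemma contract_in_box:
  fixes L :: "'a::euclidean_space"
  assumes L: "\<And>c. c \<in> Basis \<Longrightarrow> 0 < L \<bullet> c" and r: "0 < r" "r < 1" and x: "x \<in> cbox 0 L"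
  shows "contract L r x \<in> box 0 L"
  unfolding mem_box
proof
  fix c :: 'a assume c: "c \<in> Basis"
  have x: "0 \<le> x \<bullet> c" "x \<bullet> c \<le> L \<bullet> c" using x c by (auto simp: mem_box)
  have eq: "contract L r x \<bullet> c = (1 - r) * (L \<bullet> c / 2) + r * (x \<bullet> c)"
  proof -
    have "1/2 * l + r * (z - 1/2 * l) = (1 - r) * (l / 2) + r * z" for l z
      by (simp add: field_simps)
    then show ?thesis by (simp only: contract_def inner_add_left inner_diff_left inner_scaleR_left)
  qed
  have pos: "0 < (1 - r) * (L \<bullet> c / 2)" using L[OF c] r by simp
  have "0 \<le> r * (x \<bullet> c)" "r * (x \<bullet> c) \<le> r * (L \<bullet> c)"
    using x r by (auto intro: mult_left_mono)
  moreover have "(1 - r) * (L \<bullet> c / 2) + r * (L \<bullet> c) = L \<bullet> c - (1 - r) * (L \<bullet> c / 2)"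
  proof -
    have "(1 - r) * h + r * (2 * h) = 2 * h - (1 - r) * h" for h :: real
      by (simp add: algebra_simps)
    from this[of "L \<bullet> c / 2"] show ?thesis by simp
  qed
  ultimately show "0 \<bullet> c < contract L r x \<bullet> c \<and> contract L r x \<bullet> c < L \<bullet> c"
    using pos unfolding eq by simp
qed

lemma dist_contract: "dist (contract L r x) x = \<bar>1 - r\<bar> * norm (x - (1/2) *\<^sub>R L)"
proof -
  have "h + r *\<^sub>R (x - h) - x = (r - 1) *\<^sub>R (x - h)" for h
    by (simp add: algebra_simps)
  then have "contract L r x - x = (r - 1) *\<^sub>R (x - (1/2) *\<^sub>R L)"
    unfolding contract_def .
  then show ?thesis by (simp add: dist_norm abs_minus_commute)
qed

lemma contracted_uniform_limit:
  fixes u :: "'a::euclidean_space \<Rightarrow> real"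
  assumes L: "\<And>c. c \<in> Basis \<Longrightarrow> 0 < L \<bullet> c" and u: "continuous_on (cbox 0 L) u"
    and r: "\<And>n. 0 < r n \<and> r n < 1" "r \<longlonglongrightarrow> 1"
  shows "uniform_limit (cbox 0 L) (\<lambda>n x. u (contract L (r n) x)) u sequentially"
proof (rule uniform_limitI)
  fix e :: real assume "0 < e"
  have "uniformly_continuous_on (cbox 0 L) u"
    by (rule compact_uniformly_continuous[OF u compact_cbox])
  then obtain d where d: "0 < d"
    and close: "\<And>x y. x \<in> cbox 0 L \<Longrightarrow> y \<in> cbox 0 L \<Longrightarrow> dist y x < d \<Longrightarrow> dist (u y) (u x) < e"
    using \<open>0 < e\<close> unfolding uniformly_continuous_on_def by metis
  have "bounded ((\<lambda>x. x - (1/2) *\<^sub>R L) ` cbox 0 L)"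
    by (intro compact_imp_bounded compact_continuous_image continuous_intros compact_cbox)
  then obtain B where B: "0 < B" "\<And>x. x \<in> cbox 0 L \<Longrightarrow> norm (x - (1/2) *\<^sub>R L) \<le> B"
    unfolding bounded_pos by blast
  have "(\<lambda>n. \<bar>1 - r n\<bar> * B) \<longlonglongrightarrow> \<bar>1 - 1\<bar> * B" by (intro tendsto_intros r)
  then have "eventually (\<lambda>n. \<bar>1 - r n\<bar> * B < d) sequentially"
    using d by (intro order_tendstoD(2)) auto
  then show "eventually (\<lambda>n. \<forall>x\<in>cbox 0 L. dist (u (contract L (r n) x)) (u x) < e) sequentially"
  proof (rule eventually_mono)
    fix n assume n: "\<bar>1 - r n\<bar> * B < d"
    show "\<forall>x\<in>cbox 0 L. dist (u (contract L (r n) x)) (u x) < e"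
    proof
      fix x assume x: "x \<in> cbox 0 L"
      have "dist (contract L (r n) x) x \<le> \<bar>1 - r n\<bar> * B"
        unfolding dist_contract by (intro mult_left_mono B x) simp
      moreover have "contract L (r n) x \<in> cbox 0 L"
        using contract_in_box[OF L _ _ x] r(1) box_subset_cbox by blast
      ultimately show "dist (u (contract L (r n) x)) (u x) < e"
        using close[OF x] n by simp
    qed
  qed
qed

text \<open>On a segment in direction $b$ the function $g$ is the derivative of $v\, \partial_b w - w\, \partial_b v$,
  where $w$ is the contraction of $u$ and $v$ the sine. As $v$ vanishes at the end points, the integral
  of $g$ over the segment involves only the values of $w$ there, which are at most $M$ in absolute
  value, and $|\partial_b v| \le k_b$, the frequency in direction $b$.\<close>

lemma Green_bound_coordinate:
  fixes L :: "'a::euclidean_space" and m :: "'a \<Rightarrow> nat"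
  assumes L: "\<And>c. c \<in> Basis \<Longrightarrow> 0 < L \<bullet> c" and r: "0 < r" "r < 1" and b: "b \<in> Basis"
    and C2: "C2_on (box 0 L) u" 
    and M: "\<And>x. x \<in> frontier (box 0 L) \<Longrightarrow> \<bar>u (contract L r x)\<bar> \<le> M" and M0: "0 \<le> M"
  defines "g \<equiv> \<lambda>x. sine_mode L m x * (r\<^sup>2 * partial_derivative b (partial_derivative b u) (contract L r x)
      + (sine_freq L m b)\<^sup>2 * u (contract L r x))"
  shows "continuous_on (cbox 0 L) g"
    and "\<bar>integral (cbox 0 L) g\<bar> \<le> 2 * sine_freq L m b * (\<Prod>c\<in>Basis - {b}. L \<bullet> c) * M"
proof -
  let ?k = "sine_freq L m b" and ?\<phi> = "contract L r"
  have k: "0 \<le> ?k" using L[OF b] by (simp add: sine_freq_def)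
  have img: "?\<phi> ` cbox 0 L \<subseteq> box 0 L" using contract_in_box[OF L r] by blast
  have diff: "u differentiable at z" "partial_derivative b u differentiable at z" if "z \<in> box 0 L" for z
    using C2 b that by (auto simp: C2_on_def differentiable_on_eq_differentiable_at[OF open_box])
  have cont: "continuous_on (box 0 L) u" "continuous_on (box 0 L) (partial_derivative b (partial_derivative b u))"
    using C2 b by (auto simp: C2_on_def intro: differentiable_imp_continuous_on)
  have cont': "continuous_on (cbox 0 L) (\<lambda>x. u (?\<phi> x))"
    "continuous_on (cbox 0 L) (\<lambda>x. partial_derivative b (partial_derivative b u) (?\<phi> x))"
    by (rule continuous_on_compose2[OF cont(1) continuous_on_contract img],
        rule continuous_on_compose2[OF cont(2) continuous_on_contract img])
  show g: "continuous_on (cbox 0 L) g"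
    unfolding g_def by (intro continuous_intros continuous_on_sine_mode cont')
  have "\<bar>integral (cbox 0 L) g\<bar> \<le> 2 * ?k * M * (\<Prod>c\<in>Basis - {b}. L \<bullet> c - 0 \<bullet> c)"
  proof (rule integral_cbox_line_bound[OF g b])
    show "0 \<bullet> c \<le> L \<bullet> c" if "c \<in> Basis" for c using L[OF that] by simp
    show "0 \<le> 2 * ?k * M" using k M0 by simp
    fix y assume line: "\<And>t. t \<in> {0 \<bullet> b..L \<bullet> b} \<Longrightarrow> y + t *\<^sub>R b \<in> cbox 0 L" and yb: "y \<bullet> b = 0"
    define P where "P = (\<Prod>c\<in>Basis - {b}. sin (sine_freq L m c * (y \<bullet> c)))"
    have P: "\<bar>P\<bar> \<le> 1" unfolding P_def abs_prod by (intro prod_le_1) auto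
    have mode: "sine_mode L m (y + t *\<^sub>R b) = sin (?k * t) * P" for t
    proof -
      have "sine_mode L m (y + t *\<^sub>R b) = sin (?k * ((y + t *\<^sub>R b) \<bullet> b))
          * (\<Prod>c\<in>Basis - {b}. sin (sine_freq L m c * ((y + t *\<^sub>R b) \<bullet> c)))"
        using sine_mode_update[OF b, of L m "m b"] by (simp add: sine_freq_def)
      also have "(\<Prod>c\<in>Basis - {b}. sin (sine_freq L m c * ((y + t *\<^sub>R b) \<bullet> c))) = P"
        unfolding P_def using b by (intro prod.cong) (auto simp: inner_add_left inner_Basis)
      also have "(y + t *\<^sub>R b) \<bullet> b = t" using b yb by (simp add: inner_add_left)
      finally show ?thesis .
    qed
    \<comment> \<open>Restricted to the segment, the sine is $P \sin(k_b t)$; \<open>F\<close> is the antiderivative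
      $v\, \partial_b w - w\, \partial_b v$.\<close>
    define F where "F t = P * (sin (?k * t) * (r * partial_derivative b u (?\<phi> y + t *\<^sub>R (r *\<^sub>R b)))
        - ?k * cos (?k * t) * u (?\<phi> y + t *\<^sub>R (r *\<^sub>R b)))" for t
    have "(F has_vector_derivative g (y + t *\<^sub>R b)) (at t within {0..L \<bullet> b})" if t: "t \<in> {0..L \<bullet> b}" for t
    proof -
      let ?z = "?\<phi> y + t *\<^sub>R (r *\<^sub>R b)"
      have z: "?z \<in> box 0 L"
        using contract_in_box[OF L r line] t by (simp add: contract_line)
      note d1 = line_derivative[OF diff(1)[OF z], of "{0..L \<bullet> b}"]
      note d2 = line_derivative[OF diff(2)[OF z], of "{0..L \<bullet> b}"]
      have "(F has_real_derivative P * (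
            (sin (?k * t) * (r * (r * partial_derivative b (partial_derivative b u) ?z))
              + (?k * cos (?k * t)) * (r * partial_derivative b u ?z))
          - (?k * cos (?k * t) * (r * partial_derivative b u ?z)
              + (?k * (- sin (?k * t) * ?k)) * u ?z))) (at t within {0..L \<bullet> b})"
        unfolding F_def[abs_def]
        by (rule derivative_eq_intros d1 d2 refl | simp add: algebra_simps)+
      moreover have "P * (
            (sin (?k * t) * (r * (r * partial_derivative b (partial_derivative b u) ?z))
              + (?k * cos (?k * t)) * (r * partial_derivative b u ?z))
          - (?k * cos (?k * t) * (r * partial_derivative b u ?z)
              + (?k * (- sin (?k * t) * ?k)) * u ?z)) = g (y + t *\<^sub>R b)"
        by (simp add: g_def mode contract_line power2_eq_square algebra_simps)
      ultimately show ?thesis by (simp add: has_real_derivative_iff_has_vector_derivative)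
    qed
    then have "((\<lambda>t. g (y + t *\<^sub>R b)) has_integral (F (L \<bullet> b) - F 0)) {0..L \<bullet> b}"
      using L[OF b] by (intro fundamental_theorem_of_calculus) auto
    then have eq: "integral {0 \<bullet> b..L \<bullet> b} (\<lambda>t. g (y + t *\<^sub>R b)) = F (L \<bullet> b) - F 0"
      by (simp add: integral_unique)
    have edge: "\<bar>F t\<bar> \<le> ?k * M" if t: "t = 0 \<or> t = L \<bullet> b" for t
    proof -
      have tin: "t \<in> {0 \<bullet> b..L \<bullet> b}" using t L[OF b] by auto
      have sin0: "sin (?k * t) = 0" using t L[OF b] by (auto simp: sine_freq_def)
      have "(y + t *\<^sub>R b) \<bullet> b = t" using b yb by (simp add: inner_add_left)
      then have "y + t *\<^sub>R b \<notin> box 0 L"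
        using t b unfolding mem_box by (metis inner_zero_left less_irrefl)
      then have "y + t *\<^sub>R b \<in> frontier (box 0 L)"
        using line[OF tin] box_nonempty[OF L] by (simp add: frontier_box)
      from M[OF this] have uM: "\<bar>u (?\<phi> y + t *\<^sub>R (r *\<^sub>R b))\<bar> \<le> M"
        unfolding contract_line .
      have "\<bar>F t\<bar> = \<bar>P\<bar> * (?k * \<bar>cos (?k * t)\<bar> * \<bar>u (?\<phi> y + t *\<^sub>R (r *\<^sub>R b))\<bar>)"
        using k by (simp add: F_def sin0 abs_mult)
      also have "\<dots> \<le> 1 * (?k * 1 * M)"
        using P k uM M0 by (intro mult_mono) auto
      finally show ?thesis by simp
    qed
    show "\<bar>integral {0 \<bullet> b..L \<bullet> b} (\<lambda>t. g (y + t *\<^sub>R b))\<bar> \<le> 2 * ?k * M"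
      unfolding eq using edge[of 0] edge[of "L \<bullet> b"] by (simp add: algebra_simps)
  qed
  then show "\<bar>integral (cbox 0 L) g\<bar> \<le> 2 * ?k * (\<Prod>c\<in>Basis - {b}. L \<bullet> c) * M"
    by (simp add: mult.assoc mult.commute[of M])
qed

text \<open>Summation over the coordinates. The contraction $w$ of $u$ satisfies $-\Delta w = r^2 \lambda w$, so
  the sum of the integrands is $(\mu - r^2 \lambda) v w$.\<close>

lemma Green_bound:
  fixes L :: "'a::euclidean_space"
  assumes L: "\<And>c. c \<in> Basis \<Longrightarrow> 0 < L \<bullet> c" and r: "0 < r" "r < 1"
    and C2: "C2_on (box 0 L) u" and eig: "\<And>x. x \<in> box 0 L \<Longrightarrow> - laplacian u x = lam * u x"
    and M: "\<And>x. x \<in> frontier (box 0 L) \<Longrightarrow> \<bar>u (contract L r x)\<bar> \<le> M" and M0: "0 \<le> M"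
  shows "\<bar>(box_eigenvalue L m - r\<^sup>2 * lam) * integral (cbox 0 L) (\<lambda>x. sine_mode L m x * u (contract L r x))\<bar>
    \<le> (\<Sum>b\<in>Basis. 2 * sine_freq L m b * (\<Prod>c\<in>Basis - {b}. L \<bullet> c)) * M"
proof -
  define g where "g b x = sine_mode L m x * (r\<^sup>2 * partial_derivative b (partial_derivative b u) (contract L r x)
      + (sine_freq L m b)\<^sup>2 * u (contract L r x))" for b x
  note G = Green_bound_coordinate[OF L r _ C2 M M0, of _ m, folded g_def]
  have sum: "(\<Sum>b\<in>Basis. g b x) = (box_eigenvalue L m - r\<^sup>2 * lam) * (sine_mode L m x * u (contract L r x))"
    if x: "x \<in> cbox 0 L" for x
  proof -
    have "(\<Sum>b\<in>Basis. g b x)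
        = sine_mode L m x * (r\<^sup>2 * laplacian u (contract L r x) + box_eigenvalue L m * u (contract L r x))"
      by (simp add: g_def laplacian_def box_eigenvalue_def sum_distrib_left sum_distrib_right
          sum.distrib distrib_left)
    also have "laplacian u (contract L r x) = - lam * u (contract L r x)"
      using eig[OF contract_in_box[OF L r x]] by simp
    finally show ?thesis by (simp add: algebra_simps)
  qed
  have "(box_eigenvalue L m - r\<^sup>2 * lam) * integral (cbox 0 L) (\<lambda>x. sine_mode L m x * u (contract L r x))
      = integral (cbox 0 L) (\<lambda>x. \<Sum>b\<in>Basis. g b x)"
    unfolding integral_mult_right[symmetric] by (intro integral_cong) (simp add: sum)
  also have "\<dots> = (\<Sum>b\<in>Basis. integral (cbox 0 L) (g b))"
    using G(1) by (intro integral_sum integrable_continuous) auto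
  also have "\<bar>\<dots>\<bar> \<le> (\<Sum>b\<in>Basis. 2 * sine_freq L m b * (\<Prod>c\<in>Basis - {b}. L \<bullet> c) * M)"
    by (rule order_trans[OF sum_abs]) (intro sum_mono G(2))
  finally show ?thesis by (simp add: sum_distrib_right)
qed

text \<open>Let $r \to 1$ in the preceding bound: the contractions converge to $u$ uniformly on the closed box,
  so the integrals converge, and the bound $M$ for the boundary values can be taken arbitrarily small.\<close>

lemma Green_identity:
  fixes L :: "'a::euclidean_space"
  assumes L: "\<And>c. c \<in> Basis \<Longrightarrow> 0 < L \<bullet> c" and u: "dirichlet_eigenfunction (box 0 L) lam u"
  shows "(box_eigenvalue L m - lam) * integral (cbox 0 L) (\<lambda>x. sine_mode L m x * u x) = 0"
proof -
  let ?v = "sine_mode L m"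
  have ne: "box 0 L \<noteq> {}" by (rule box_nonempty[OF L])
  have C2: "C2_on (box 0 L) u" and cont: "continuous_on (cbox 0 L) u"
    and eig: "\<And>x. x \<in> box 0 L \<Longrightarrow> - laplacian u x = lam * u x"
    and zero: "\<And>x. x \<in> frontier (box 0 L) \<Longrightarrow> u x = 0"
    using u ne by (auto simp: dirichlet_eigenfunction_def closure_box)
  have front: "frontier (box 0 L) \<subseteq> cbox 0 L" using ne by (auto simp: frontier_box)
  define r where "r n = 1 - 1 / (real n + 2)" for n
  have r01: "0 < r n \<and> r n < 1" for n by (simp add: r_def field_simps)
  have r: "r \<longlonglongrightarrow> 1"
  proof -
    have "(\<lambda>n. 1 / (real (n + 2))) \<longlonglongrightarrow> 0"
      by (rule LIMSEQ_ignore_initial_segment[OF lim_1_over_n])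
    from tendsto_diff[OF tendsto_const[of 1] this] show ?thesis
      by (simp add: r_def[abs_def] add.commute)
  qed
  have unif: "uniform_limit (cbox 0 L) (\<lambda>n x. u (contract L (r n) x)) u sequentially"
    by (rule contracted_uniform_limit[OF L cont r01 r])
  have "uniform_limit (cbox 0 L) (\<lambda>n x. ?v x * u (contract L (r n) x)) (\<lambda>x. ?v x * u x) sequentially"
  proof (rule uniform_limitI)
    fix e :: real assume "0 < e"
    from uniform_limitD[OF unif this]
    show "eventually (\<lambda>n. \<forall>x\<in>cbox 0 L. dist (?v x * u (contract L (r n) x)) (?v x * u x) < e) sequentially"
    proof (rule eventually_mono)
      fix n assume *: "\<forall>x\<in>cbox 0 L. dist (u (contract L (r n) x)) (u x) < e"
      have "dist (?v x * u (contract L (r n) x)) (?v x * u x) \<le> 1 * dist (u (contract L (r n) x)) (u x)" for x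
        unfolding dist_real_def right_diff_distrib[symmetric] abs_mult
        by (intro mult_right_mono abs_sine_mode_le_1) simp
      from le_less_trans[OF this] *
      show "\<forall>x\<in>cbox 0 L. dist (?v x * u (contract L (r n) x)) (?v x * u x) < e"
        by simp
    qed
  qed
  moreover have "continuous_on (cbox 0 L) (\<lambda>x. ?v x * u (contract L (r n) x))" for n
  proof -
    have "contract L (r n) ` cbox 0 L \<subseteq> cbox 0 L"
      using contract_in_box[OF L] r01 box_subset_cbox by blast
    from continuous_on_compose2[OF cont continuous_on_contract this] show ?thesis
      by (intro continuous_intros continuous_on_sine_mode)
  qed
  ultimately obtain I J where I: "\<And>n. ((\<lambda>x. ?v x * u (contract L (r n) x)) has_integral I n) (cbox 0 L)"
    and J: "((\<lambda>x. ?v x * u x) has_integral J) (cbox 0 L)" and lim: "I \<longlonglongrightarrow> J"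
    by (rule uniform_limit_integral_cbox[where F = sequentially]) auto
  define A where "A = (\<Sum>b\<in>Basis. 2 * sine_freq L m b * (\<Prod>c\<in>Basis - {b}. L \<bullet> c))"
  have A: "0 \<le> A"
    unfolding A_def using L by (intro sum_nonneg mult_nonneg_nonneg prod_nonneg) (auto simp: sine_freq_def less_imp_le)
  have lim': "(\<lambda>n. \<bar>(box_eigenvalue L m - (r n)\<^sup>2 * lam) * I n\<bar>)
      \<longlonglongrightarrow> \<bar>(box_eigenvalue L m - 1\<^sup>2 * lam) * J\<bar>"
    by (intro tendsto_intros lim r)
  have "\<bar>(box_eigenvalue L m - lam) * J\<bar> \<le> 0 + e" if e: "0 < e" for e
  proof -
    \<comment> \<open>The summand 1 keeps the quotient defined in case \<open>A\<close> is 0.\<close>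
    define M where "M = e / (A + 1)"
    have M: "0 < M" using e A by (simp add: M_def)
    have "eventually (\<lambda>n. \<bar>(box_eigenvalue L m - (r n)\<^sup>2 * lam) * I n\<bar> \<le> A * M) sequentially"
      using uniform_limitD[OF unif M]
    proof (rule eventually_mono)
      fix n assume *: "\<forall>x\<in>cbox 0 L. dist (u (contract L (r n) x)) (u x) < M"
      have "\<bar>u (contract L (r n) x)\<bar> \<le> M" if "x \<in> frontier (box 0 L)" for x
        using * zero[OF that] that front by (force simp: dist_real_def)
      from Green_bound[OF L _ _ C2 eig this, of m] r01[of n] M
      show "\<bar>(box_eigenvalue L m - (r n)\<^sup>2 * lam) * I n\<bar> \<le> A * M"
        by (simp add: A_def integral_unique[OF I])
    qed
    then have "\<bar>(box_eigenvalue L m - 1\<^sup>2 * lam) * J\<bar> \<le> A * M"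
      by (intro tendsto_upperbound[OF lim']) auto
    also have "A * M \<le> e" using A e by (simp add: M_def field_simps)
    finally show ?thesis by simp
  qed
  then have "\<bar>(box_eigenvalue L m - lam) * J\<bar> \<le> 0" by (rule field_le_epsilon)
  then show ?thesis by (simp add: integral_unique[OF J])
qed

text \<open>An eigenfunction for any other value would be orthogonal to all sines, hence zero by completeness.\<close>

lemma dirichlet_eigenvalue_box:
  fixes L :: "'a::euclidean_space"
  assumes L: "\<And>c. c \<in> Basis \<Longrightarrow> 0 < L \<bullet> c" and u: "dirichlet_eigenfunction (box 0 L) lam u"
  shows "\<exists>m\<in>multi_indices. lam = box_eigenvalue L m"
proof (rule ccontr)
  assume none: "\<not> (\<exists>m\<in>multi_indices. lam = box_eigenvalue L m)"
  have ne: "box 0 L \<noteq> {}" by (rule box_nonempty[OF L])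
  have cont: "continuous_on (cbox 0 L) u"
    using u ne by (simp add: dirichlet_eigenfunction_def closure_box)
  obtain x where x: "x \<in> box 0 L" "u x \<noteq> 0"
    using u by (auto simp: dirichlet_eigenfunction_def)
  have u2: "u \<in> L2_on (box 0 L)" by (rule L2_continuous[OF cont])
  have "L2_inner (box 0 L) u (sine_mode L (index_enum k)) = 0" for k
  proof -
    have "index_enum k \<in> (multi_indices :: ('a \<Rightarrow> nat) set)"
      using bij_betwE[OF bij_index_enum] by blast
    then have "box_eigenvalue L (index_enum k) - lam \<noteq> 0" using none by auto
    then have "integral (cbox 0 L) (\<lambda>x. sine_mode L (index_enum k) x * u x) = 0"
      using Green_identity[OF L u, of "index_enum k"] by simp
    then show ?thesis
      by (simp add: L2_inner_continuous[OF cont continuous_on_sine_mode] mult.commute)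
  qed
  then have "L2_inner (box 0 L) u u = 0"
    using sine_eigenbasis[OF L] unfolding dirichlet_eigenbasis_def
    by (intro L2_orthogonal_basis_total[OF _ u2]) auto
  then show False
    using L2_inner_pos_of_continuous[OF open_box continuous_on_subset[OF cont box_subset_cbox] u2 x] by blast
qed

section \<open>The fundamental gap\<close>

lemma L2_sums_single:
  assumes u: "\<And>m. u m \<in> L2_on S"
  shows "L2_sums S (\<lambda>m x. (if m = k then c else 0) * u m x) (\<lambda>x. c * u k x)"
proof -
  have "(\<Sum>m<N. (if m = k then c else 0) * u m x) = c * u k x" if "k < N" for N x
  proof -
    have "(\<Sum>m<N. (if m = k then c else 0) * u m x) = (\<Sum>m<N. if m = k then c * u k x else 0)"
      by (intro sum.cong) auto
    then show ?thesis using that by simp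
  qed
  then have "(\<lambda>N. LINT x|lebesgue_on S. (c * u k x - (\<Sum>m<N. (if m = k then c else 0) * u m x))\<^sup>2) \<longlonglongrightarrow> 0"
    by (intro tendsto_eventually eventually_sequentiallyI[of "Suc k"]) simp
  then show ?thesis
    unfolding L2_sums_def using u by (auto intro: L2_cmult L2_zero)
qed

text \<open>Each sine is an eigenfunction of the fractional operator, its expansion having a single term. The
  converse combines the coefficient comparison with the description of the Dirichlet spectrum.\<close>

lemma schroedinger_eigenvalue_box_iff:
  fixes L :: "'a::euclidean_space"
  assumes L: "\<And>c. c \<in> Basis \<Longrightarrow> 0 < L \<bullet> c"
  shows "local_schroedinger_eigenvalue (box 0 L) (\<lambda>x. 0) \<alpha> l
    \<longleftrightarrow> (\<exists>m\<in>multi_indices. l = box_eigenvalue L m powr (\<alpha> / 2))"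
proof
  assume "local_schroedinger_eigenvalue (box 0 L) (\<lambda>x. 0) \<alpha> l"
  from schroedinger_eigenvalue_imp_powr[OF open_box this] dirichlet_eigenvalue_box[OF L]
  show "\<exists>m\<in>multi_indices. l = box_eigenvalue L m powr (\<alpha> / 2)" by metis
next
  assume "\<exists>m\<in>multi_indices. l = box_eigenvalue L m powr (\<alpha> / 2)"
  then obtain m where m: "m \<in> multi_indices" and l: "l = box_eigenvalue L m powr (\<alpha> / 2)" by blast
  have "m \<in> range index_enum" using m bij_index_enum unfolding bij_betw_def by blast
  then obtain k where k: "m = index_enum k" by blast
  have L2: "sine_mode L n \<in> L2_on (box 0 L)" for n
    by (intro L2_continuous continuous_on_sine_mode)
  have dir: "dirichlet_eigenfunction (box 0 L) (box_eigenvalue L m) (sine_mode L m)"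
    using m by (intro sine_mode_dirichlet L) (auto simp: multi_indices_def)
  have "local_frac_laplacian (box 0 L) \<alpha> (sine_mode L m) (\<lambda>x. l * sine_mode L m x)"
    unfolding local_frac_laplacian_def
  proof (intro exI conjI)
    show "dirichlet_eigenbasis (box 0 L) (\<lambda>k. box_eigenvalue L (index_enum k)) (\<lambda>k. sine_mode L (index_enum k))"
      by (rule sine_eigenbasis[OF L])
    show "L2_sums (box 0 L) (\<lambda>j x. (if j = k then 1 else 0) * sine_mode L (index_enum j) x) (sine_mode L m)"
      using L2_sums_single[of "\<lambda>j. sine_mode L (index_enum j)" "box 0 L" k 1] L2 by (simp add: k)
    have "(\<lambda>j x. (if j = k then l else 0) * sine_mode L (index_enum j) x)
        = (\<lambda>j x. (if j = k then 1 else 0) * box_eigenvalue L (index_enum j) powr (\<alpha> / 2)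
            * sine_mode L (index_enum j) x)"
      by (auto simp: fun_eq_iff l k)
    then show "L2_sums (box 0 L) (\<lambda>j x. (if j = k then 1 else 0) * box_eigenvalue L (index_enum j) powr (\<alpha> / 2)
            * sine_mode L (index_enum j) x) (\<lambda>x. l * sine_mode L m x)"
      using L2_sums_single[of "\<lambda>j. sine_mode L (index_enum j)" "box 0 L" k l] L2 by (simp add: k)
  qed
  then show "local_schroedinger_eigenvalue (box 0 L) (\<lambda>x. 0) \<alpha> l"
    unfolding local_schroedinger_eigenvalue_def
    using dir by (intro exI[of _ "sine_mode L m"] exI[of _ "\<lambda>x. l * sine_mode L m x"])
      (simp add: dirichlet_eigenfunction_def)
qed

lemma box_eigenvalue_ground: "box_eigenvalue L ground_index = (\<Sum>c\<in>Basis. (pi / (L \<bullet> c))\<^sup>2)"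
  unfolding box_eigenvalue_def by (intro sum.cong) (auto simp: sine_freq_def ground_index)

lemma box_eigenvalue_excited:
  fixes L :: "'a::euclidean_space"
  assumes a: "a \<in> Basis"
  shows "ground_index(a := 2) \<in> multi_indices"
    and "box_eigenvalue L (ground_index(a := 2)) = box_eigenvalue L ground_index + 3 * (pi / (L \<bullet> a))\<^sup>2"
proof -
  show "ground_index(a := 2) \<in> multi_indices"
    using ground_index(1) a unfolding multi_indices_def by (auto simp: PiE_iff extensional_def)
  have split: "box_eigenvalue L m = (sine_freq L m a)\<^sup>2 + (\<Sum>c\<in>Basis - {a}. (sine_freq L m c)\<^sup>2)" for m
    unfolding box_eigenvalue_def using a by (intro sum.remove) auto
  have "(\<Sum>c\<in>Basis - {a}. (sine_freq L (ground_index(a := 2)) c)\<^sup>2)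
      = (\<Sum>c\<in>Basis - {a}. (sine_freq L ground_index c)\<^sup>2)"
    by (intro sum.cong) (auto simp: sine_freq_def)
  moreover have "(sine_freq L (ground_index(a := 2)) a)\<^sup>2 = (sine_freq L ground_index a)\<^sup>2 + 3 * (pi / (L \<bullet> a))\<^sup>2"
    using a by (simp add: sine_freq_def ground_index power_divide power_mult_distrib)
  ultimately show "box_eigenvalue L (ground_index(a := 2)) = box_eigenvalue L ground_index + 3 * (pi / (L \<bullet> a))\<^sup>2"
    by (simp add: split)
qed

text \<open>An index other than $(1,\dots,1)$ has an entry $m_b \ge 2$, and raising this entry from 1 costs at least
  $3 (\pi/L_b)^2$, which is smallest for the longest side.\<close>

lemma box_eigenvalue_lower:
  fixes L :: "'a::euclidean_space"
  assumes L: "\<And>c. c \<in> Basis \<Longrightarrow> 0 < L \<bullet> c" and a: "\<And>c. c \<in> Basis \<Longrightarrow> L \<bullet> c \<le> L \<bullet> a"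
    and m: "m \<in> multi_indices" "m \<noteq> ground_index"
  shows "box_eigenvalue L ground_index + 3 * (pi / (L \<bullet> a))\<^sup>2 \<le> box_eigenvalue L m"
proof -
  have pos: "1 \<le> m c" if "c \<in> Basis" for c
    using m(1) that by (force simp: multi_indices_def)
  have "\<exists>b\<in>Basis. m b \<noteq> ground_index b"
    using PiE_ext[OF m(1)[unfolded multi_indices_def] ground_index(1)[unfolded multi_indices_def]] m(2) by blast
  then obtain b where b: "b \<in> Basis" "m b \<noteq> 1" by (auto simp: ground_index)
  have m2: "2 \<le> m b" using b pos[OF b(1)] by simp
  have "(\<Sum>c\<in>Basis - {b}. (sine_freq L ground_index c)\<^sup>2) \<le> (\<Sum>c\<in>Basis - {b}. (sine_freq L m c)\<^sup>2)"
    using L pos by (intro sum_mono power_mono) (auto simp: sine_freq_def ground_index divide_right_mono less_imp_le)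
  moreover have "(sine_freq L ground_index b)\<^sup>2 + 3 * (pi / (L \<bullet> a))\<^sup>2 \<le> (sine_freq L m b)\<^sup>2"
  proof -
    have "(pi / (L \<bullet> a))\<^sup>2 \<le> (pi / (L \<bullet> b))\<^sup>2"
      using L[OF b(1)] a[OF b(1)] by (intro power_mono divide_left_mono) auto
    then have "(sine_freq L ground_index b)\<^sup>2 + 3 * (pi / (L \<bullet> a))\<^sup>2 \<le> 2\<^sup>2 * (pi / (L \<bullet> b))\<^sup>2"
      using b by (simp add: sine_freq_def ground_index)
    also have "\<dots> \<le> (real (m b))\<^sup>2 * (pi / (L \<bullet> b))\<^sup>2"
      using m2 by (intro mult_right_mono power_mono) auto
    finally show ?thesis by (simp add: sine_freq_def power_mult_distrib power_divide)
  qed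
  ultimately show ?thesis
    unfolding box_eigenvalue_def
    using sum.remove[OF finite_Basis b(1), of "\<lambda>c. (sine_freq L m c)\<^sup>2"]
      sum.remove[OF finite_Basis b(1), of "\<lambda>c. (sine_freq L ground_index c)\<^sup>2"] by simp
qed

text \<open>Both minima are attained, so the definite descriptions denote them. The two powers are distinct since
  $\alpha > 0$.\<close>

lemma local_fundamental_gap_box:
  fixes L :: "'a::euclidean_space"
  assumes L: "\<And>c. c \<in> Basis \<Longrightarrow> 0 < L \<bullet> c"
    and a: "a \<in> Basis" "\<And>c. c \<in> Basis \<Longrightarrow> L \<bullet> c \<le> L \<bullet> a" and \<alpha>: "0 < \<alpha>"
  shows "local_fundamental_gap (box 0 L) (\<lambda>x. 0) \<alpha>
    = ((\<Sum>c\<in>Basis. (pi / (L \<bullet> c))\<^sup>2) + 3 * (pi / (L \<bullet> a))\<^sup>2) powr (\<alpha> / 2)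
      - (\<Sum>c\<in>Basis. (pi / (L \<bullet> c))\<^sup>2) powr (\<alpha> / 2)"
proof -
  define E where "E = box_eigenvalue L ground_index"
  define \<delta> where "\<delta> = 3 * (pi / (L \<bullet> a))\<^sup>2"
  have \<delta>: "0 < \<delta>" using L[OF a(1)] by (simp add: \<delta>_def)
  have E: "0 \<le> E" unfolding E_def box_eigenvalue_def by (intro sum_nonneg) auto
  note iff = schroedinger_eigenvalue_box_iff[OF L]
  have lower: "m = ground_index \<or> E + \<delta> \<le> box_eigenvalue L m" if "m \<in> multi_indices" for m
    using box_eigenvalue_lower[OF L a(2) that] by (auto simp: E_def \<delta>_def)
  have first: "local_first_eigenvalue (box 0 L) (\<lambda>x. 0) \<alpha> = E powr (\<alpha> / 2)"
    unfolding local_first_eigenvalue_def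
  proof (rule Least_equality)
    show "local_schroedinger_eigenvalue (box 0 L) (\<lambda>x. 0) \<alpha> (E powr (\<alpha> / 2))"
      using ground_index(1) by (auto simp: iff E_def)
    fix l assume "local_schroedinger_eigenvalue (box 0 L) (\<lambda>x. 0) \<alpha> l"
    then obtain m where m: "m \<in> multi_indices" "l = box_eigenvalue L m powr (\<alpha> / 2)" by (auto simp: iff)
    then have "E \<le> box_eigenvalue L m" using lower[OF m(1)] \<delta> by (auto simp: E_def)
    then show "E powr (\<alpha> / 2) \<le> l" using E \<alpha> by (simp add: m(2) powr_mono2)
  qed
  have "local_second_eigenvalue (box 0 L) (\<lambda>x. 0) \<alpha> = (E + \<delta>) powr (\<alpha> / 2)"
    unfolding local_second_eigenvalue_def first
  proof (rule Least_equality)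
    have "E powr (\<alpha> / 2) < (E + \<delta>) powr (\<alpha> / 2)"
      using E \<delta> \<alpha> by (intro powr_less_mono2) auto
    then show "local_schroedinger_eigenvalue (box 0 L) (\<lambda>x. 0) \<alpha> ((E + \<delta>) powr (\<alpha> / 2))
        \<and> (E + \<delta>) powr (\<alpha> / 2) \<noteq> E powr (\<alpha> / 2)"
      using box_eigenvalue_excited(1)[OF a(1)] box_eigenvalue_excited(2)[OF a(1), of L] by (auto simp: iff E_def \<delta>_def intro!: bexI)
    fix l assume l: "local_schroedinger_eigenvalue (box 0 L) (\<lambda>x. 0) \<alpha> l \<and> l \<noteq> E powr (\<alpha> / 2)"
    then obtain m where m: "m \<in> multi_indices" "l = box_eigenvalue L m powr (\<alpha> / 2)" by (auto simp: iff)
    then have "E + \<delta> \<le> box_eigenvalue L m" using lower[OF m(1)] l by (auto simp: E_def)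
    then show "(E + \<delta>) powr (\<alpha> / 2) \<le> l" using E \<delta> \<alpha> by (simp add: m(2) powr_mono2)
  qed
  then show ?thesis
    by (simp add: local_fundamental_gap_def first E_def \<delta>_def box_eigenvalue_ground)
qed

lemma powr_diff_lower_bound:
  fixes x y \<beta> :: real
  assumes "0 < x" "x < y" "0 \<le> \<beta>" "\<beta> \<le> 1"
  shows "\<beta> * y powr (\<beta> - 1) * (y - x) \<le> y powr \<beta> - x powr \<beta>"
proof -
  have "\<exists>z. x < z \<and> z < y \<and> y powr \<beta> - x powr \<beta> = (y - x) * (\<beta> * z powr (\<beta> - 1))"
    using assms by (intro MVT2) (auto intro!: derivative_eq_intros)
  then obtain z where z: "x < z" "z < y" and eq: "y powr \<beta> - x powr \<beta> = (y - x) * (\<beta> * z powr (\<beta> - 1))"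
    by blast
  have "y powr (\<beta> - 1) \<le> z powr (\<beta> - 1)"
    using assms z by (intro powr_mono2') auto
  then show ?thesis
    unfolding eq using assms by (simp add: mult.commute mult_left_mono mult.left_commute)
qed

text \<open>By the mean value bound, the difference is at least
  $\beta y^{\beta-1} \cdot 3 (\pi/l)^2$ with $\beta = \alpha/2$ and $y = E + 3(\pi/l)^2 \le (n+3)(\pi/d)^2$.
  The factor $3/2$ that this has in excess of the claim absorbs the replacement of $n+3$ by $n+2$, because
  $((n+3)/(n+2))^{1-\beta} \le 3/2$.\<close>

lemma powr_gap_bound:
  fixes \<alpha> d l D E :: real
  assumes \<alpha>: "0 < \<alpha>" "\<alpha> \<le> 2" and d: "0 < d" "d \<le> l" and D: "l\<^sup>2 \<le> D\<^sup>2"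
    and E: "0 < E" "E \<le> real n * (pi / d)\<^sup>2"
  shows "\<alpha> * pi powr \<alpha> / (real n + 2) powr (1 - \<alpha> / 2) * (d powr (2 - \<alpha>) / D\<^sup>2)
    \<le> (E + 3 * (pi / l)\<^sup>2) powr (\<alpha> / 2) - E powr (\<alpha> / 2)"
proof -
  define \<beta> where "\<beta> = \<alpha> / 2"
  have \<beta>: "0 < \<beta>" "\<beta> \<le> 1" using \<alpha> by (auto simp: \<beta>_def)
  have l: "0 < l" using d by linarith
  define y where "y = E + 3 * (pi / l)\<^sup>2"
  have y: "E < y" using l by (simp add: y_def)
  have "(pi / l)\<^sup>2 \<le> (pi / d)\<^sup>2" using d l by (intro power_mono divide_left_mono) auto
  then have y_le: "y \<le> (real n + 3) * (pi / d)\<^sup>2" using E by (simp add: y_def distrib_right)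
  have "(real n + 3) powr (\<beta> - 1) * (pi / d) powr (2 * (\<beta> - 1)) = ((real n + 3) * (pi / d)\<^sup>2) powr (\<beta> - 1)"
    using d by (simp add: powr_mult powr_powr flip: powr_numeral)
  also have "\<dots> \<le> y powr (\<beta> - 1)"
    using y_le y E \<beta> by (intro powr_mono2') auto
  finally have powr_y: "(real n + 3) powr (\<beta> - 1) * (pi / d) powr (2 * (\<beta> - 1)) \<le> y powr (\<beta> - 1)" .
  have ratio: "(real n + 2) powr (\<beta> - 1) \<le> 3 / 2 * (real n + 3) powr (\<beta> - 1)"
  proof -
    have "((real n + 3) / (real n + 2)) powr (1 - \<beta>) \<le> ((real n + 3) / (real n + 2)) powr 1"
      using \<beta> by (intro powr_mono) (auto simp: field_simps)
    also have "\<dots> \<le> 3 / 2" by (simp add: field_simps)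
    finally have "((real n + 3) / (real n + 2)) powr (1 - \<beta>) \<le> 3 / 2" .
    moreover have "(real n + 2) powr (\<beta> - 1) = ((real n + 3) / (real n + 2)) powr (1 - \<beta>) * (real n + 3) powr (\<beta> - 1)"
      by (simp add: powr_divide powr_minus_divide[of _ "1 - \<beta>", simplified])
    ultimately show ?thesis by (simp add: mult_right_mono)
  qed
  have pi_d: "pi powr \<alpha> * d powr (2 - \<alpha>) = (pi / d) powr (2 * (\<beta> - 1)) * pi\<^sup>2"
  proof -
    have "pi powr \<alpha> = pi powr (\<alpha> - 2) * pi\<^sup>2"
      by (simp add: powr_diff)
    moreover have "d powr (2 - \<alpha>) = 1 / d powr (\<alpha> - 2)"
      using powr_minus_divide[of d "\<alpha> - 2"] by simp
    moreover have "2 * (\<beta> - 1) = \<alpha> - 2" by (simp add: \<beta>_def)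
    ultimately show ?thesis using d by (simp add: powr_divide)
  qed
  have "\<alpha> * pi powr \<alpha> / (real n + 2) powr (1 - \<alpha> / 2) * (d powr (2 - \<alpha>) / D\<^sup>2)
      = 2 * \<beta> * (real n + 2) powr (\<beta> - 1) * ((pi / d) powr (2 * (\<beta> - 1)) * pi\<^sup>2) / D\<^sup>2"
    unfolding pi_d[symmetric] using powr_minus_divide[of "real n + 2" "1 - \<beta>"] by (simp add: \<beta>_def)
  also have "\<dots> \<le> 2 * \<beta> * (3 / 2 * (real n + 3) powr (\<beta> - 1)) * ((pi / d) powr (2 * (\<beta> - 1)) * pi\<^sup>2) / l\<^sup>2"
    using \<beta> ratio l D by (intro frac_le mult_right_mono mult_left_mono mult_nonneg_nonneg) auto
  also have "\<dots> = \<beta> * ((real n + 3) powr (\<beta> - 1) * (pi / d) powr (2 * (\<beta> - 1))) * (3 * (pi / l)\<^sup>2)"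
    by (simp add: power_divide)
  also have "\<dots> \<le> \<beta> * y powr (\<beta> - 1) * (y - E)"
    using \<beta> powr_y by (simp add: y_def mult_right_mono mult_left_mono)
  also have "\<dots> \<le> y powr \<beta> - E powr \<beta>"
    using powr_diff_lower_bound[OF E(1) y] \<beta> by simp
  finally show ?thesis by (simp add: y_def \<beta>_def)
qed

theorem lemma2p2:
  fixes L :: "real ^ 'n::{finite,linorder}"
    and \<Omega> :: "(real ^ 'n::{finite,linorder}) set"
    and \<alpha> D d :: real
  assumes "CARD('n) \<in> {1, 2, 3}"
    and "\<And>i j. i \<le> j \<Longrightarrow> L $ j \<le> L $ i"
    and "\<And>i. 0 < L $ i"
    and "\<Omega> = {x. \<forall>j. 0 < x $ j \<and> x $ j < L $ j}"
    and "D = sqrt (\<Sum>j\<in>UNIV. (L $ j)\<^sup>2)"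
    and "d = L $ Max UNIV"
    and "0 < \<alpha>" and "\<alpha> \<le> 2"
  shows "local_fundamental_gap \<Omega> (\<lambda>x. 0) \<alpha> \<ge>
    (if CARD('n) = 1 then (2 powr \<alpha> - 1) * pi powr \<alpha> / D powr \<alpha>
     else \<alpha> * pi powr \<alpha> / (real CARD('n) + 2) powr (1 - \<alpha> / 2)
            * (d powr (2 - \<alpha>) / D\<^sup>2))"
proof -
  note decreasing = assms(2) and pos = assms(3)
  define a :: 'n where "a = Min UNIV"
  have a: "L $ j \<le> L $ a" for j unfolding a_def by (intro decreasing Min_le) auto
  have d: "d \<le> L $ j" for j unfolding assms(6) by (intro decreasing Max_ge) auto
  have \<Omega>: "\<Omega> = box 0 L" unfolding assms(4) by (auto simp: mem_box_cart)
  have Basis: "Basis = range (\<lambda>j::'n. axis j (1::real))" by (auto simp: Basis_vec_def)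
  have inj: "inj (\<lambda>j::'n. axis j (1::real))" by (auto simp: inj_def axis_eq_axis)
  define E where "E = (\<Sum>j\<in>UNIV. (pi / (L $ j))\<^sup>2)"
  have E: "(\<Sum>c\<in>Basis. (pi / (L \<bullet> c))\<^sup>2) = E"
    unfolding E_def Basis by (subst sum.reindex[OF inj]) (simp add: inner_axis)
  have gap: "local_fundamental_gap \<Omega> (\<lambda>x. 0) \<alpha> = (E + 3 * (pi / (L $ a))\<^sup>2) powr (\<alpha> / 2) - E powr (\<alpha> / 2)"
  proof -
    have L: "0 < L \<bullet> c" "L \<bullet> c \<le> L \<bullet> axis a 1" if "c \<in> Basis" for c
      using that pos a by (auto simp: Basis inner_axis)
    have "axis a 1 \<in> (Basis :: (real ^ 'n::{finite,linorder}) set)" by (simp add: Basis)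
    from local_fundamental_gap_box[OF L(1) this L(2) assms(7)]
    have "local_fundamental_gap (box 0 L) (\<lambda>x. 0) \<alpha>
        = ((\<Sum>c\<in>Basis. (pi / (L \<bullet> c))\<^sup>2) + 3 * (pi / (L \<bullet> axis a 1))\<^sup>2) powr (\<alpha> / 2)
          - (\<Sum>c\<in>Basis. (pi / (L \<bullet> c))\<^sup>2) powr (\<alpha> / 2)"
      .
    then show ?thesis
      by (simp add: \<Omega> E inner_axis)
  qed
  have D2: "D\<^sup>2 = (\<Sum>j\<in>UNIV. (L $ j)\<^sup>2)"
    unfolding assms(5) by (intro real_sqrt_pow2 sum_nonneg) simp
  show ?thesis
  proof (cases "CARD('n) = 1")
    case True
    then obtain i :: 'n where "UNIV = {i}" by (auto simp: card_1_singleton_iff)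
    then have U: "UNIV = {a}" by (metis UNIV_I singletonD)
    have "D = L $ a" using pos[of a] by (simp add: assms(5) U)
    moreover have "E = (pi / L $ a)\<^sup>2" by (simp add: E_def U)
    moreover have "((pi / L $ a)\<^sup>2) powr (\<alpha> / 2) = pi powr \<alpha> / (L $ a) powr \<alpha>"
    proof -
      have "((pi / L $ a)\<^sup>2) powr (\<alpha> / 2) = (pi / L $ a) powr \<alpha>"
        using pos[of a] by (simp add: powr_powr flip: powr_numeral)
      then show ?thesis using pos[of a] by (simp add: powr_divide)
    qed
    moreover have "(4 * (pi / L $ a)\<^sup>2) powr (\<alpha> / 2) = 2 powr \<alpha> * ((pi / L $ a)\<^sup>2) powr (\<alpha> / 2)"
    proof -
      have "(4::real) powr (\<alpha> / 2) = 2 powr \<alpha>"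
        using powr_powr[of 2 2 "\<alpha> / 2"] by simp
      then show ?thesis by (simp add: powr_mult)
    qed
    ultimately show ?thesis using True by (simp add: gap left_diff_distrib diff_divide_distrib)
  next
    case False
    have "0 < E" unfolding E_def using pos by (intro sum_pos) (auto simp: less_imp_neq[symmetric])
    moreover have "E \<le> real CARD('n) * (pi / d)\<^sup>2"
    proof -
      have "0 < d" using pos by (simp add: assms(6))
      then have "(pi / L $ j)\<^sup>2 \<le> (pi / d)\<^sup>2" for j
        using d[of j] pos[of j] by (intro power_mono divide_left_mono) auto
      then have "E \<le> (\<Sum>j\<in>(UNIV :: 'n set). (pi / d)\<^sup>2)" unfolding E_def by (intro sum_mono)
      then show ?thesis by simp
    qed
    moreover have "(L $ a)\<^sup>2 \<le> D\<^sup>2"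
      unfolding D2 by (rule member_le_sum) auto
    ultimately show ?thesis
      using False powr_gap_bound[OF assms(7,8) _ d[of a], where n = "CARD('n)" and E = E and D = D] pos
      by (simp add: gap assms(6))
  qed
qed

end
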